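(* Let $M$ be a $(2n+s)$-dimensional $S$-manifold whose $f$-sectional curvature with respect to the Riemannian (Levi-Civita) connection $\nabla$ is constant equal to $c$, and consider on $M$ the semi-symmetric non-metric connection $$\widetilde\nabla_XY=\nabla_XY+\sum_{j=1}^s\eta^j(Y)X.$$ Then the $\mathcal{L}$-sectional curvature of $\widetilde\nabla$ satisfies $$\widetilde K_{\mathcal{L}}(X,Y)=\frac{c+3s}{4}+\frac{3(c-s)}{4}g(X,fY)^2$$ for any orthonormal vector fields $X,Y\in\mathcal{L}$, and the scalar curvature of $M$ with respect to $\widetilde\nabla$ satisfies $$\widetilde\tau=\frac{n(n+1)(c+3s)+s(s-1)}{2}.$$
   Context: A metric $f$-manifold is a $(2n+s)$-dimensional differentiable manifold $M$ ($n,s\geq 1$) with a $(1,1)$ tensor field $f$, vector fields $\xi_1,\dots,\xi_s$ (structure vector fields), 1-forms $\eta^1,\dots,\eta^s$ and a Riemannian metric $g$ such that $f^2=-I+\sum_{\alpha=1}^s\eta^\alpha\otimes\xi_\alpha$, $\eta^\alpha(\xi_\beta)=\delta_{\alpha\beta}$, $f\xi_\alpha=0$, $\eta^\alpha\circ f=0$, $g(fX,fY)=g(X,Y)-\sum_{\alpha=1}^s\eta^\alpha(X)\eta^\alpha(Y)$; moreover $\eta^\alpha(X)=g(X,\xi_\alpha)$ and $g(X,fY)=-g(fX,Y)$. The fundamental 2-form is $\Phi(X,Y)=g(X,fY)$. $M$ is an $S$-manifold if it is normal, i.e. $[f,f]+2\sum_{\alpha=1}^s d\eta^\alpha\otimes\xi_\alpha=0$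 with $[f,f](X,Y)=f^2[X,Y]+[fX,fY]-f[fX,Y]-f[X,fY]$, and for every $1\leq\alpha\leq s$: $\eta^1\wedge\cdots\wedge\eta^s\wedge(d\eta^\alpha)^n\neq 0$ everywhere and $\Phi=d\eta^\alpha$. Convention: $d\eta(X,Y)=\frac12\left(X\eta(Y)-Y\eta(X)-\eta([X,Y])\right)$. $\mathcal{L}$ is the distribution orthogonal to the span of $\xi_1,\dots,\xi_s$. For a linear connection $D$ with curvature $R^D(X,Y)Z=D_XD_YZ-D_YD_XZ-D_{[X,Y]}Z$, put $K^D(X,Y)=g(R^D(X,Y)Y,X)$ for orthonormal $X,Y$; write $K$ for $D=\nabla$ and $\widetilde K$ for $D=\widetilde\nabla$ ($\widetilde K$ is in general not symmetric in $X,Y$). The $f$-sectional curvature with respect to $\nabla$ is $K(X,fX)$ for unit $X\in\mathcal{L}$. The $\mathcal{L}$-sectional curvature of $\widetilde\nabla$ is $\widetilde K_{\mathcal{L}}(X,Y)=\widetilde K(X,Y)$ for orthonormal $X,Y\in\mathcal{L}$. The scalar curvature with respect to $\widetilde\nabla$ is $\widetilde\tau=\frac12\sum_{i,j=1}^{2n+s}\widetilde K(e_i,e_j)$ (sum over ordered pairs) for any local orthonormal frame $\{e_1,\dots,e_{2n+s}\}$, the terms with $i=j$ being zero. *)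

theory Defs
  imports "HOL-Analysis.Analysis" "HOL-Combinatorics.Permutations"
begin

subsection \<open>Smooth manifolds\<close>

primrec k_smooth_on :: "nat \<Rightarrow> 'a::euclidean_space set \<Rightarrow> ('a \<Rightarrow> 'b::euclidean_space) \<Rightarrow> bool" where
  "k_smooth_on 0 S h \<longleftrightarrow> continuous_on S h"
| "k_smooth_on (Suc k) S h \<longleftrightarrow> (\<forall>x\<in>S. h differentiable (at x)) \<and>
     (\<forall>v. k_smooth_on k S (\<lambda>x. frechet_derivative h (at x) v))"

text \<open>Only used for open sets \<open>S\<close>.\<close>

definition smooth_on :: "'a::euclidean_space set \<Rightarrow> ('a \<Rightarrow> 'b::euclidean_space) \<Rightarrow> bool" where
  "smooth_on S h \<longleftrightarrow> (\<forall>k. k_smooth_on k S h)"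

type_synonym ('p, 'e) atlas = "('p set \<times> ('p \<Rightarrow> 'e)) set"

text \<open>The underlying set of the manifold is the whole type \<open>'p\<close>, its dimension is \<open>DIM('e)\<close>;
  the type classes supply the Hausdorff and second countability axioms.\<close>

definition smooth_manifold ::
    "('p::{t2_space,second_countable_topology}, 'e::euclidean_space) atlas \<Rightarrow> bool" where
  "smooth_manifold A \<longleftrightarrow>
     (\<Union>(U, \<phi>)\<in>A. U) = UNIV \<and>
     (\<forall>(U, \<phi>)\<in>A. open U \<and> open (\<phi> ` U) \<and> homeomorphism U (\<phi> ` U) \<phi> (inv_into U \<phi>)) \<and>
     (\<forall>(U, \<phi>)\<in>A. \<forall>(V, \<psi>)\<in>A. smooth_on (\<phi> ` (U \<inter> V)) (\<psi> \<circ> inv_into U \<phi>))"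

definition smooth_funs :: "('p, 'e::euclidean_space) atlas \<Rightarrow> ('p \<Rightarrow> real) set" where
  "smooth_funs A = {F. \<forall>(U, \<phi>)\<in>A. smooth_on (\<phi> ` U) (F \<circ> inv_into U \<phi>)}"

text \<open>A tangent vector at \<open>p\<close> is a derivation at \<open>p\<close> of the algebra of smooth functions. It is set
  to \<open>0\<close> on non-smooth functions, so that equality of tangent vectors is equality in HOL.\<close>

type_synonym 'p tvec = "('p \<Rightarrow> real) \<Rightarrow> real"
type_synonym 'p vfield = "'p \<Rightarrow> 'p tvec"

definition tangent_space :: "('p, 'e::euclidean_space) atlas \<Rightarrow> 'p \<Rightarrow> 'p tvec set" where
  "tangent_space A p = {v.
     (\<forall>F. F \<notin> smooth_funs A \<longrightarrow> v F = 0) \<and>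
     (\<forall>F\<in>smooth_funs A. \<forall>G\<in>smooth_funs A. \<forall>a b.
        v (\<lambda>q. a * F q + b * G q) = a * v F + b * v G) \<and>
     (\<forall>F\<in>smooth_funs A. \<forall>G\<in>smooth_funs A.
        v (\<lambda>q. F q * G q) = F p * v G + G p * v F)}"

definition vfields :: "('p, 'e::euclidean_space) atlas \<Rightarrow> 'p vfield set" where
  "vfields A = {X. (\<forall>p. X p \<in> tangent_space A p) \<and>
     (\<forall>F\<in>smooth_funs A. (\<lambda>p. X p F) \<in> smooth_funs A)}"

definition lie_bracket :: "'p vfield \<Rightarrow> 'p vfield \<Rightarrow> 'p vfield" where
  "lie_bracket X Y = (\<lambda>p F. X p (\<lambda>q. Y q F) - Y p (\<lambda>q. X q F))"

subsection \<open>Tensor fields\<close>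

definition one_form :: "('p, 'e::euclidean_space) atlas \<Rightarrow> ('p \<Rightarrow> 'p tvec \<Rightarrow> real) \<Rightarrow> bool" where
  "one_form A \<omega> \<longleftrightarrow>
     (\<forall>p. \<forall>u\<in>tangent_space A p. \<forall>v\<in>tangent_space A p. \<forall>a b.
        \<omega> p (\<lambda>F. a * u F + b * v F) = a * \<omega> p u + b * \<omega> p v) \<and>
     (\<forall>X\<in>vfields A. (\<lambda>p. \<omega> p (X p)) \<in> smooth_funs A)"

definition tensor_field_1_1 :: "('p, 'e::euclidean_space) atlas \<Rightarrow> ('p \<Rightarrow> 'p tvec \<Rightarrow> 'p tvec) \<Rightarrow> bool" where
  "tensor_field_1_1 A f \<longleftrightarrow>
     (\<forall>p. \<forall>u\<in>tangent_space A p. f p u \<in> tangent_space A p) \<and>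
     (\<forall>p. \<forall>u\<in>tangent_space A p. \<forall>v\<in>tangent_space A p. \<forall>a b.
        f p (\<lambda>F. a * u F + b * v F) = (\<lambda>F. a * f p u F + b * f p v F)) \<and>
     (\<forall>X\<in>vfields A. (\<lambda>p. f p (X p)) \<in> vfields A)"

definition riemannian_metric ::
    "('p, 'e::euclidean_space) atlas \<Rightarrow> ('p \<Rightarrow> 'p tvec \<Rightarrow> 'p tvec \<Rightarrow> real) \<Rightarrow> bool" where
  "riemannian_metric A g \<longleftrightarrow>
     (\<forall>p. \<forall>u\<in>tangent_space A p. \<forall>v\<in>tangent_space A p. g p u v = g p v u) \<and>
     (\<forall>p. \<forall>u\<in>tangent_space A p. \<forall>v\<in>tangent_space A p. \<forall>w\<in>tangent_space A p. \<forall>a b.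
        g p (\<lambda>F. a * u F + b * v F) w = a * g p u w + b * g p v w) \<and>
     (\<forall>p. \<forall>u\<in>tangent_space A p. u \<noteq> (\<lambda>F. 0) \<longrightarrow> g p u u > 0) \<and>
     (\<forall>X\<in>vfields A. \<forall>Y\<in>vfields A. (\<lambda>p. g p (X p) (Y p)) \<in> smooth_funs A)"

definition apply_tensor :: "('p \<Rightarrow> 'p tvec \<Rightarrow> 'p tvec) \<Rightarrow> 'p vfield \<Rightarrow> 'p vfield" where
  "apply_tensor f X = (\<lambda>p. f p (X p))"

text \<open>Exterior derivative of a 1-form, with the factor \<open>1/2\<close>.\<close>

definition ext_deriv :: "('p \<Rightarrow> 'p tvec \<Rightarrow> real) \<Rightarrow> 'p vfield \<Rightarrow> 'p vfield \<Rightarrow> 'p \<Rightarrow> real" where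
  "ext_deriv \<omega> X Y p = (1/2) *
     (X p (\<lambda>q. \<omega> q (Y q)) - Y p (\<lambda>q. \<omega> q (X q)) - \<omega> p (lie_bracket X Y p))"

text \<open>A \<open>k\<close>-form is encoded as a map \<open>\<omega>\<close> where \<open>\<omega> X p\<close> is its value at \<open>p\<close> on the vector
  fields \<open>X 0, \<dots>, X (k - 1)\<close>. The normalization of the wedge product is the one that
  belongs to the factor \<open>1/2\<close> above.\<close>

type_synonym 'p form = "(nat \<Rightarrow> 'p vfield) \<Rightarrow> 'p \<Rightarrow> real"

definition wedge :: "nat \<Rightarrow> nat \<Rightarrow> 'p form \<Rightarrow> 'p form \<Rightarrow> 'p form" where
  "wedge k l \<omega> \<theta> X p =
     (\<Sum>\<sigma> | \<sigma> permutes {..<k + l}.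
        of_int (sign \<sigma>) * \<omega> (\<lambda>i. X (\<sigma> i)) p * \<theta> (\<lambda>i. X (\<sigma> (k + i))) p) / fact (k + l)"

primrec wedge_one_forms :: "(nat \<Rightarrow> 'p \<Rightarrow> 'p tvec \<Rightarrow> real) \<Rightarrow> nat \<Rightarrow> 'p form" where
  "wedge_one_forms \<eta> 0 = (\<lambda>X p. 1)"
| "wedge_one_forms \<eta> (Suc k) = wedge k 1 (wedge_one_forms \<eta> k) (\<lambda>X p. \<eta> (Suc k) p (X 0 p))"

primrec wedge_power :: "('p vfield \<Rightarrow> 'p vfield \<Rightarrow> 'p \<Rightarrow> real) \<Rightarrow> nat \<Rightarrow> 'p form" where
  "wedge_power \<Omega> 0 = (\<lambda>X p. 1)"
| "wedge_power \<Omega> (Suc k) = wedge (2 * k) 2 (wedge_power \<Omega> k) (\<lambda>X p. \<Omega> (X 0) (X 1) p)"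

subsection \<open>Metric f-manifolds and S-manifolds\<close>

text \<open>The structure vector fields and 1-forms are indexed by \<open>1, \<dots>, s\<close>.\<close>

definition metric_f_manifold ::
    "('p::{t2_space,second_countable_topology}, 'e::euclidean_space) atlas \<Rightarrow> nat \<Rightarrow> nat \<Rightarrow>
     ('p \<Rightarrow> 'p tvec \<Rightarrow> 'p tvec) \<Rightarrow> (nat \<Rightarrow> 'p vfield) \<Rightarrow> (nat \<Rightarrow> 'p \<Rightarrow> 'p tvec \<Rightarrow> real) \<Rightarrow>
     ('p \<Rightarrow> 'p tvec \<Rightarrow> 'p tvec \<Rightarrow> real) \<Rightarrow> bool" where
  "metric_f_manifold A n s f \<xi> \<eta> g \<longleftrightarrow>
     smooth_manifold A \<and> n \<ge> 1 \<and> s \<ge> 1 \<and> DIM('e) = 2 * n + s \<and>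
     tensor_field_1_1 A f \<and>
     (\<forall>\<alpha>\<in>{1..s}. \<xi> \<alpha> \<in> vfields A \<and> one_form A (\<eta> \<alpha>)) \<and>
     riemannian_metric A g \<and>
     (\<forall>p. \<forall>u\<in>tangent_space A p.
        f p (f p u) = (\<lambda>F. - u F + (\<Sum>\<alpha>=1..s. \<eta> \<alpha> p u * \<xi> \<alpha> p F))) \<and>
     (\<forall>p. \<forall>\<alpha>\<in>{1..s}. \<forall>\<beta>\<in>{1..s}. \<eta> \<alpha> p (\<xi> \<beta> p) = (if \<alpha> = \<beta> then 1 else 0)) \<and>
     (\<forall>p. \<forall>\<alpha>\<in>{1..s}. f p (\<xi> \<alpha> p) = (\<lambda>F. 0)) \<and>
     (\<forall>p. \<forall>\<alpha>\<in>{1..s}. \<forall>u\<in>tangent_space A p. \<eta> \<alpha> p (f p u) = 0) \<and>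
     (\<forall>p. \<forall>u\<in>tangent_space A p. \<forall>v\<in>tangent_space A p.
        g p (f p u) (f p v) = g p u v - (\<Sum>\<alpha>=1..s. \<eta> \<alpha> p u * \<eta> \<alpha> p v)) \<and>
     (\<forall>p. \<forall>\<alpha>\<in>{1..s}. \<forall>u\<in>tangent_space A p. \<eta> \<alpha> p u = g p u (\<xi> \<alpha> p)) \<and>
     (\<forall>p. \<forall>u\<in>tangent_space A p. \<forall>v\<in>tangent_space A p. g p u (f p v) = - g p (f p u) v)"

definition fundamental_form ::
    "('p \<Rightarrow> 'p tvec \<Rightarrow> 'p tvec \<Rightarrow> real) \<Rightarrow> ('p \<Rightarrow> 'p tvec \<Rightarrow> 'p tvec) \<Rightarrow>
     'p vfield \<Rightarrow> 'p vfield \<Rightarrow> 'p \<Rightarrow> real" where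
  "fundamental_form g f X Y p = g p (X p) (f p (Y p))"

definition nijenhuis ::
    "('p \<Rightarrow> 'p tvec \<Rightarrow> 'p tvec) \<Rightarrow> 'p vfield \<Rightarrow> 'p vfield \<Rightarrow> 'p vfield" where
  "nijenhuis f X Y = (let f' = apply_tensor f in (\<lambda>p F.
     f' (f' (lie_bracket X Y)) p F + lie_bracket (f' X) (f' Y) p F
     - f' (lie_bracket (f' X) Y) p F - f' (lie_bracket X (f' Y)) p F))"

definition normal_structure ::
    "('p, 'e::euclidean_space) atlas \<Rightarrow> nat \<Rightarrow> ('p \<Rightarrow> 'p tvec \<Rightarrow> 'p tvec) \<Rightarrow>
     (nat \<Rightarrow> 'p vfield) \<Rightarrow> (nat \<Rightarrow> 'p \<Rightarrow> 'p tvec \<Rightarrow> real) \<Rightarrow> bool" where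
  "normal_structure A s f \<xi> \<eta> \<longleftrightarrow>
     (\<forall>X\<in>vfields A. \<forall>Y\<in>vfields A. \<forall>p F.
        nijenhuis f X Y p F + 2 * (\<Sum>\<alpha>=1..s. ext_deriv (\<eta> \<alpha>) X Y p * \<xi> \<alpha> p F) = 0)"

definition S_manifold ::
    "('p::{t2_space,second_countable_topology}, 'e::euclidean_space) atlas \<Rightarrow> nat \<Rightarrow> nat \<Rightarrow>
     ('p \<Rightarrow> 'p tvec \<Rightarrow> 'p tvec) \<Rightarrow> (nat \<Rightarrow> 'p vfield) \<Rightarrow> (nat \<Rightarrow> 'p \<Rightarrow> 'p tvec \<Rightarrow> real) \<Rightarrow>
     ('p \<Rightarrow> 'p tvec \<Rightarrow> 'p tvec \<Rightarrow> real) \<Rightarrow> bool" where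
  "S_manifold A n s f \<xi> \<eta> g \<longleftrightarrow>
     metric_f_manifold A n s f \<xi> \<eta> g \<and>
     normal_structure A s f \<xi> \<eta> \<and>
     (\<forall>\<alpha>\<in>{1..s}.
        (\<forall>p. \<exists>X. (\<forall>i<2 * n + s. X i \<in> vfields A) \<and>
           wedge s (2 * n) (wedge_one_forms \<eta> s) (wedge_power (ext_deriv (\<eta> \<alpha>)) n) X p \<noteq> 0) \<and>
        (\<forall>X\<in>vfields A. \<forall>Y\<in>vfields A. \<forall>p.
           fundamental_form g f X Y p = ext_deriv (\<eta> \<alpha>) X Y p))"

definition distr_L ::
    "('p, 'e::euclidean_space) atlas \<Rightarrow> nat \<Rightarrow> (nat \<Rightarrow> 'p vfield) \<Rightarrow>
     ('p \<Rightarrow> 'p tvec \<Rightarrow> 'p tvec \<Rightarrow> real) \<Rightarrow> 'p \<Rightarrow> 'p tvec set" where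
  "distr_L A s \<xi> g p = {v \<in> tangent_space A p. \<forall>\<alpha>\<in>{1..s}. g p v (\<xi> \<alpha> p) = 0}"

subsection \<open>Connections and curvature\<close>

definition linear_connection ::
    "('p, 'e::euclidean_space) atlas \<Rightarrow> ('p vfield \<Rightarrow> 'p vfield \<Rightarrow> 'p vfield) \<Rightarrow> bool" where
  "linear_connection A D \<longleftrightarrow>
     (\<forall>X\<in>vfields A. \<forall>Y\<in>vfields A. D X Y \<in> vfields A) \<and>
     (\<forall>X\<in>vfields A. \<forall>Y\<in>vfields A. \<forall>Z\<in>vfields A.
        D (\<lambda>p F. X p F + Y p F) Z = (\<lambda>p F. D X Z p F + D Y Z p F) \<and>
        D X (\<lambda>p F. Y p F + Z p F) = (\<lambda>p F. D X Y p F + D X Z p F)) \<and>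
     (\<forall>h\<in>smooth_funs A. \<forall>X\<in>vfields A. \<forall>Y\<in>vfields A.
        D (\<lambda>p F. h p * X p F) Y = (\<lambda>p F. h p * D X Y p F) \<and>
        D X (\<lambda>p F. h p * Y p F) = (\<lambda>p F. X p h * Y p F + h p * D X Y p F))"

definition levi_civita ::
    "('p, 'e::euclidean_space) atlas \<Rightarrow> ('p \<Rightarrow> 'p tvec \<Rightarrow> 'p tvec \<Rightarrow> real) \<Rightarrow>
     ('p vfield \<Rightarrow> 'p vfield \<Rightarrow> 'p vfield) \<Rightarrow> bool" where
  "levi_civita A g D \<longleftrightarrow>
     linear_connection A D \<and>
     (\<forall>X\<in>vfields A. \<forall>Y\<in>vfields A. \<forall>p F. D X Y p F - D Y X p F = lie_bracket X Y p F) \<and>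
     (\<forall>X\<in>vfields A. \<forall>Y\<in>vfields A. \<forall>Z\<in>vfields A. \<forall>p.
        X p (\<lambda>q. g q (Y q) (Z q)) = g p (D X Y p) (Z p) + g p (Y p) (D X Z p))"

definition semi_symmetric_connection ::
    "nat \<Rightarrow> (nat \<Rightarrow> 'p \<Rightarrow> 'p tvec \<Rightarrow> real) \<Rightarrow> ('p vfield \<Rightarrow> 'p vfield \<Rightarrow> 'p vfield) \<Rightarrow>
     'p vfield \<Rightarrow> 'p vfield \<Rightarrow> 'p vfield" where
  "semi_symmetric_connection s \<eta> D X Y = (\<lambda>p F. D X Y p F + (\<Sum>j=1..s. \<eta> j p (Y p)) * X p F)"

definition curvature ::
    "('p vfield \<Rightarrow> 'p vfield \<Rightarrow> 'p vfield) \<Rightarrow> 'p vfield \<Rightarrow> 'p vfield \<Rightarrow> 'p vfield \<Rightarrow> 'p vfield" where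
  "curvature D X Y Z = (\<lambda>p F. D X (D Y Z) p F - D Y (D X Z) p F - D (lie_bracket X Y) Z p F)"

text \<open>The value at \<open>p\<close> depends only on \<open>X p\<close> and \<open>Y p\<close>, so it is meant to be used for fields
  that are orthonormal at \<open>p\<close>; they need not be orthonormal elsewhere.\<close>

definition sectional_curvature ::
    "('p \<Rightarrow> 'p tvec \<Rightarrow> 'p tvec \<Rightarrow> real) \<Rightarrow> ('p vfield \<Rightarrow> 'p vfield \<Rightarrow> 'p vfield) \<Rightarrow>
     'p vfield \<Rightarrow> 'p vfield \<Rightarrow> 'p \<Rightarrow> real" where
  "sectional_curvature g D X Y p = g p (curvature D X Y Y p) (X p)"

definition constant_f_sectional_curvature ::
    "('p, 'e::euclidean_space) atlas \<Rightarrow> nat \<Rightarrow> ('p \<Rightarrow> 'p tvec \<Rightarrow> 'p tvec) \<Rightarrow>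
     (nat \<Rightarrow> 'p vfield) \<Rightarrow> ('p \<Rightarrow> 'p tvec \<Rightarrow> 'p tvec \<Rightarrow> real) \<Rightarrow>
     ('p vfield \<Rightarrow> 'p vfield \<Rightarrow> 'p vfield) \<Rightarrow> real \<Rightarrow> bool" where
  "constant_f_sectional_curvature A s f \<xi> g D c \<longleftrightarrow>
     (\<forall>p. \<forall>X\<in>vfields A. X p \<in> distr_L A s \<xi> g p \<and> g p (X p) (X p) = 1 \<longrightarrow>
        sectional_curvature g D X (apply_tensor f X) p = c)"

text \<open>A local frame over \<open>U\<close> is represented by global vector fields which form a frame at the
  points of \<open>U\<close>. Around each of its points every local frame coincides with one of this kind,
  by multiplication with a bump function.\<close>

definition local_orthonormal_frame ::
    "('p::topological_space, 'e::euclidean_space) atlas \<Rightarrow>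
     ('p \<Rightarrow> 'p tvec \<Rightarrow> 'p tvec \<Rightarrow> real) \<Rightarrow> 'p set \<Rightarrow> nat \<Rightarrow> (nat \<Rightarrow> 'p vfield) \<Rightarrow> bool" where
  "local_orthonormal_frame A g U N E \<longleftrightarrow>
     open U \<and> (\<forall>i\<in>{1..N}. E i \<in> vfields A) \<and>
     (\<forall>p\<in>U. \<forall>i\<in>{1..N}. \<forall>j\<in>{1..N}. g p (E i p) (E j p) = (if i = j then 1 else 0)) \<and>
     (\<forall>p\<in>U. \<forall>v\<in>tangent_space A p. \<exists>a. v = (\<lambda>F. \<Sum>i=1..N. a i * E i p F))"

text \<open>For \<open>i = j\<close> the summand vanishes because \<open>curvature D X X = 0\<close>.\<close>

definition scalar_curvature ::
    "('p \<Rightarrow> 'p tvec \<Rightarrow> 'p tvec \<Rightarrow> real) \<Rightarrow> ('p vfield \<Rightarrow> 'p vfield \<Rightarrow> 'p vfield) \<Rightarrow>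
     nat \<Rightarrow> (nat \<Rightarrow> 'p vfield) \<Rightarrow> 'p \<Rightarrow> real" where
  "scalar_curvature g D N E p =
     (1/2) * (\<Sum>i=1..N. \<Sum>j=1..N. sectional_curvature g D (E i) (E j) p)"

end

(*
  Everything is computed with global vector fields, as a module over the smooth functions with
  connection and metric: splitting X into its horizontal part -f^2 X and the span of the xi_a needs
  no local frames or bump functions.

  Normality and d eta = Phi make the xi_a Killing, so nabla_X xi_a = -fX, and they force
  (nabla_X f)Y = g(fX,fY) xi + eta(Y) f^2 X, where xi and eta are the sums of the xi_a and eta^a:
  the difference of the two sides satisfies the identities of nabla J on an almost Hermitian
  manifold with integrable J and closed Kaehler form, hence vanishes. The Ricci identities for xi_a
  and f then give R(X,Y)xi_a and the commutator of R(X,Y) with f. Polarizing the quartic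
  g(R(X,fX)fX,X) = c |X|^4 on horizontal vectors yields g(R(X,Y)Y,X) for all X, Y.
  Finally the semi-symmetric connection changes K(X,Y) by eta(Y)^2 for orthonormal X, Y.
*)
theory Submission
  imports Defs "HOL-Library.Function_Algebras"
begin

section \<open>Metric connections on a module of vector fields\<close>

text \<open>The hypothesis is pointwise, about fields that are horizontal and of unit length at p,
  while the module offers only global fields, and the length of a field may vanish elsewhere. So
  fields are rescaled by constants only, the quartic reaches fields of length zero at p by
  perturbing them, and the resulting formula is stated for arbitrary fields, with the inner products
  of F X and F Y doing the work of a horizontality assumption. The constants come from xi, the sum
  of the xi_a: its dual form defines the semi-symmetric connection, |xi|^2 = s, and nabla xi = -s F
  puts the factor s into the commutator of R(X,Y) with F. On horizontal arguments this commutator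
  turns the polarized quartic into an equation for K(X,Y) + 3 K(X,FY); replacing Y by FY gives a
  second one, and the system has determinant -8. The frame in the scalar curvature is arbitrary. All
  sums over it follow from Parseval: the matrix of the projection onto L is idempotent with trace 2n
  and kills the components of xi, whose squares add up to s.\<close>

text \<open>\<open>C\<close> plays the smooth functions, \<open>V\<close> the vector fields, \<open>act X h\<close> is \<open>X(h)\<close>, and \<open>D\<close> is the
  Levi-Civita connection of \<open>ip\<close>. The bracket is not a separate datum but \<open>D X Y - D Y X\<close>.\<close>

locale lie_rinehart =
  fixes C :: "('p \<Rightarrow> real) set"
    and V :: "'v::ab_group_add set"
    and smul :: "('p \<Rightarrow> real) \<Rightarrow> 'v \<Rightarrow> 'v"
    and act :: "'v \<Rightarrow> ('p \<Rightarrow> real) \<Rightarrow> 'p \<Rightarrow> real"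
    and ip :: "'v \<Rightarrow> 'v \<Rightarrow> 'p \<Rightarrow> real"
    and D :: "'v \<Rightarrow> 'v \<Rightarrow> 'v"
  assumes C_const [simp]: "(\<lambda>_. r) \<in> C"
    and C_add [simp]: "h \<in> C \<Longrightarrow> k \<in> C \<Longrightarrow> (\<lambda>q. h q + k q) \<in> C"
    and C_mult [simp]: "h \<in> C \<Longrightarrow> k \<in> C \<Longrightarrow> (\<lambda>q. h q * k q) \<in> C"
    and V_zero [simp]: "0 \<in> V"
    and V_add [simp]: "X \<in> V \<Longrightarrow> Y \<in> V \<Longrightarrow> X + Y \<in> V"
    and V_smul [simp]: "h \<in> C \<Longrightarrow> X \<in> V \<Longrightarrow> smul h X \<in> V"
    and smul_uminus: "- X = smul (\<lambda>_. -1) X"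
    and act_C [simp]: "X \<in> V \<Longrightarrow> h \<in> C \<Longrightarrow> act X h \<in> C"
    and act_lin: "X \<in> V \<Longrightarrow> h \<in> C \<Longrightarrow> k \<in> C \<Longrightarrow>
      act X (\<lambda>q. a * h q + b * k q) p = a * act X h p + b * act X k p"
    and act_mult: "X \<in> V \<Longrightarrow> h \<in> C \<Longrightarrow> k \<in> C \<Longrightarrow>
      act X (\<lambda>q. h q * k q) p = h p * act X k p + k p * act X h p"
    and act_vadd: "X \<in> V \<Longrightarrow> Y \<in> V \<Longrightarrow> h \<in> C \<Longrightarrow> act (X + Y) h p = act X h p + act Y h p"
    and act_smul: "k \<in> C \<Longrightarrow> X \<in> V \<Longrightarrow> h \<in> C \<Longrightarrow> act (smul k X) h p = k p * act X h p"
    and act_faithful: "X \<in> V \<Longrightarrow> Y \<in> V \<Longrightarrow> (\<And>h p. h \<in> C \<Longrightarrow> act X h p = act Y h p) \<Longrightarrow> X = Y"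
    and ip_C [simp]: "X \<in> V \<Longrightarrow> Y \<in> V \<Longrightarrow> ip X Y \<in> C"
    and ip_sym: "X \<in> V \<Longrightarrow> Y \<in> V \<Longrightarrow> ip X Y p = ip Y X p"
    and ip_add_left: "X \<in> V \<Longrightarrow> Y \<in> V \<Longrightarrow> Z \<in> V \<Longrightarrow> ip (X + Y) Z p = ip X Z p + ip Y Z p"
    and ip_smul_left: "h \<in> C \<Longrightarrow> X \<in> V \<Longrightarrow> Y \<in> V \<Longrightarrow> ip (smul h X) Y p = h p * ip X Y p"
    and ip_nonneg: "X \<in> V \<Longrightarrow> ip X X p \<ge> 0"
    and ip_definite: "X \<in> V \<Longrightarrow> (\<And>p. ip X X p = 0) \<Longrightarrow> X = 0"
    and D_V [simp]: "X \<in> V \<Longrightarrow> Y \<in> V \<Longrightarrow> D X Y \<in> V"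
    and D_add_left: "X \<in> V \<Longrightarrow> Y \<in> V \<Longrightarrow> Z \<in> V \<Longrightarrow> D (X + Y) Z = D X Z + D Y Z"
    and D_add_right: "X \<in> V \<Longrightarrow> Y \<in> V \<Longrightarrow> Z \<in> V \<Longrightarrow> D X (Y + Z) = D X Y + D X Z"
    and D_smul_left: "h \<in> C \<Longrightarrow> X \<in> V \<Longrightarrow> Y \<in> V \<Longrightarrow> D (smul h X) Y = smul h (D X Y)"
    and D_smul_right: "h \<in> C \<Longrightarrow> X \<in> V \<Longrightarrow> Y \<in> V \<Longrightarrow>
      D X (smul h Y) = smul (act X h) Y + smul h (D X Y)"
    and torsion_free: "X \<in> V \<Longrightarrow> Y \<in> V \<Longrightarrow> h \<in> C \<Longrightarrow>
      act (D X Y - D Y X) h p = act X (act Y h) p - act Y (act X h) p"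
    and metric: "X \<in> V \<Longrightarrow> Y \<in> V \<Longrightarrow> Z \<in> V \<Longrightarrow> act X (ip Y Z) p = ip (D X Y) Z p + ip Y (D X Z) p"
begin

lemma V_uminus [simp]: "X \<in> V \<Longrightarrow> - X \<in> V"
  by (simp add: smul_uminus)

lemma V_diff [simp]: "X \<in> V \<Longrightarrow> Y \<in> V \<Longrightarrow> X - Y \<in> V"
  unfolding diff_conv_add_uminus by (intro V_add V_uminus)

lemma V_sum [simp]: "(\<And>i. i \<in> I \<Longrightarrow> X i \<in> V) \<Longrightarrow> sum X I \<in> V"
  by (induction I rule: infinite_finite_induct) auto

lemma C_sum [simp]: "(\<And>i. i \<in> I \<Longrightarrow> h i \<in> C) \<Longrightarrow> (\<lambda>q. \<Sum>i\<in>I. h i q) \<in> C"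
  by (induction I rule: infinite_finite_induct) auto

lemma C_cmul [simp]: "h \<in> C \<Longrightarrow> (\<lambda>q. r * h q) \<in> C"
  by simp

lemma C_diff [simp]:
  assumes "h \<in> C" "k \<in> C"
  shows "(\<lambda>q. h q - k q) \<in> C"
  using C_add[OF assms(1) C_mult[OF C_const[of "-1"] assms(2)]] by simp

lemma ip_uminus_left: "X \<in> V \<Longrightarrow> Y \<in> V \<Longrightarrow> ip (- X) Y p = - ip X Y p"
  by (simp add: smul_uminus ip_smul_left)

lemma ip_diff_left:
  assumes "X \<in> V" "Y \<in> V" "Z \<in> V"
  shows "ip (X - Y) Z p = ip X Z p - ip Y Z p"
  unfolding diff_conv_add_uminus using assms by (simp only: ip_add_left V_uminus ip_uminus_left)

lemma ip_zero_left: "X \<in> V \<Longrightarrow> ip 0 X p = 0"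
  using ip_add_left[of 0 0 X p] by simp

lemma ip_sum_left:
  "(\<And>i. i \<in> I \<Longrightarrow> X i \<in> V) \<Longrightarrow> Y \<in> V \<Longrightarrow> ip (sum X I) Y p = (\<Sum>i\<in>I. ip (X i) Y p)"
  by (induction I rule: infinite_finite_induct) (auto simp: ip_zero_left ip_add_left)

lemma ip_add_right: "X \<in> V \<Longrightarrow> Y \<in> V \<Longrightarrow> Z \<in> V \<Longrightarrow> ip Z (X + Y) p = ip Z X p + ip Z Y p"
  by (simp add: ip_sym[of Z] ip_add_left)

lemma ip_diff_right: "X \<in> V \<Longrightarrow> Y \<in> V \<Longrightarrow> Z \<in> V \<Longrightarrow> ip Z (X - Y) p = ip Z X p - ip Z Y p"
  by (simp add: ip_sym[of Z] ip_diff_left)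

lemma ip_uminus_right: "X \<in> V \<Longrightarrow> Y \<in> V \<Longrightarrow> ip Y (- X) p = - ip Y X p"
  by (simp add: ip_sym[of Y] ip_uminus_left)

lemma ip_zero_right: "X \<in> V \<Longrightarrow> ip X 0 p = 0"
  by (simp add: ip_sym[of X] ip_zero_left)

lemma ip_smul_right: "h \<in> C \<Longrightarrow> X \<in> V \<Longrightarrow> Y \<in> V \<Longrightarrow> ip Y (smul h X) p = h p * ip Y X p"
  by (simp add: ip_sym[of Y] ip_smul_left)

lemma ip_sum_right:
  "(\<And>i. i \<in> I \<Longrightarrow> X i \<in> V) \<Longrightarrow> Y \<in> V \<Longrightarrow> ip Y (sum X I) p = (\<Sum>i\<in>I. ip Y (X i) p)"
  by (simp add: ip_sym[of Y] ip_sum_left)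

lemmas ip_simps = ip_add_left ip_add_right ip_diff_left ip_diff_right ip_uminus_left ip_uminus_right
  ip_zero_left ip_zero_right ip_smul_left ip_smul_right ip_sum_left ip_sum_right

lemma ip_eqI:
  assumes "X \<in> V" "Y \<in> V" "\<And>Z p. Z \<in> V \<Longrightarrow> ip X Z p = ip Y Z p"
  shows "X = Y"
proof -
  have "X - Y = 0"
    by (rule ip_definite) (use assms in \<open>simp_all add: ip_diff_left\<close>)
  then show ?thesis by simp
qed

lemma act_add: "X \<in> V \<Longrightarrow> h \<in> C \<Longrightarrow> k \<in> C \<Longrightarrow> act X (\<lambda>q. h q + k q) p = act X h p + act X k p"
  using act_lin[of X h k 1 1 p] by simp

lemma act_fdiff: "X \<in> V \<Longrightarrow> h \<in> C \<Longrightarrow> k \<in> C \<Longrightarrow> act X (\<lambda>q. h q - k q) p = act X h p - act X k p"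
  using act_lin[of X h k 1 "-1" p] by simp

lemma act_const: "X \<in> V \<Longrightarrow> act X (\<lambda>_. r) p = 0"
  using act_mult[of X "\<lambda>_. 1" "\<lambda>_. 1" p] act_lin[of X "\<lambda>_. 1" "\<lambda>_. 1" r 0 p] by simp

lemma act_cmul: "X \<in> V \<Longrightarrow> h \<in> C \<Longrightarrow> act X (\<lambda>q. r * h q) p = r * act X h p"
  using act_lin[of X h h r 0 p] by simp

lemma act_sum:
  "X \<in> V \<Longrightarrow> (\<And>i. i \<in> I \<Longrightarrow> h i \<in> C) \<Longrightarrow> act X (\<lambda>q. \<Sum>i\<in>I. h i q) p = (\<Sum>i\<in>I. act X (h i) p)"
  by (induction I rule: infinite_finite_induct) (auto simp: act_const act_add)

lemma act_zero: "h \<in> C \<Longrightarrow> act 0 h p = 0"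
  using act_vadd[of 0 0 h p] by simp

lemma D_cmul_right: "X \<in> V \<Longrightarrow> Y \<in> V \<Longrightarrow> D X (smul (\<lambda>_. r) Y) = smul (\<lambda>_. r) (D X Y)"
  by (rule ip_eqI) (simp_all add: D_smul_right ip_simps act_const)

lemma D_uminus_left: "X \<in> V \<Longrightarrow> Y \<in> V \<Longrightarrow> D (- X) Y = - D X Y"
  by (simp add: smul_uminus D_smul_left)

lemma D_uminus_right: "X \<in> V \<Longrightarrow> Y \<in> V \<Longrightarrow> D Y (- X) = - D Y X"
  by (simp add: smul_uminus D_cmul_right)

lemma D_zero_left: "Y \<in> V \<Longrightarrow> D 0 Y = 0"
  using D_add_left[of 0 0 Y] by simp

lemma D_zero_right: "Y \<in> V \<Longrightarrow> D Y 0 = 0"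
  using D_add_right[of Y 0 0] by simp

lemma D_diff_left: "X \<in> V \<Longrightarrow> Y \<in> V \<Longrightarrow> Z \<in> V \<Longrightarrow> D (X - Y) Z = D X Z - D Y Z"
  using D_add_left[of "X - Y" Y Z] by simp

lemma D_diff_right: "X \<in> V \<Longrightarrow> Y \<in> V \<Longrightarrow> Z \<in> V \<Longrightarrow> D Z (X - Y) = D Z X - D Z Y"
  using D_add_right[of Z "X - Y" Y] by simp

lemma D_sum_right:
  "(\<And>i. i \<in> I \<Longrightarrow> X i \<in> V) \<Longrightarrow> Y \<in> V \<Longrightarrow> D Y (sum X I) = (\<Sum>i\<in>I. D Y (X i))"
  by (induction I rule: infinite_finite_induct) (auto simp: D_zero_right D_add_right)

section \<open>The bracket and the symmetries of the curvature tensor\<close>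

definition br :: "'v \<Rightarrow> 'v \<Rightarrow> 'v" where
  "br X Y = D X Y - D Y X"

lemma br_V [simp]: "X \<in> V \<Longrightarrow> Y \<in> V \<Longrightarrow> br X Y \<in> V"
  by (simp add: br_def)

lemma act_br: "X \<in> V \<Longrightarrow> Y \<in> V \<Longrightarrow> h \<in> C \<Longrightarrow> act (br X Y) h p = act X (act Y h) p - act Y (act X h) p"
  by (simp add: br_def torsion_free)

lemma act_act_br:
  assumes "X \<in> V" "Y \<in> V" "Z \<in> V" "h \<in> C"
  shows "act Z (act (br X Y) h) p = act Z (act X (act Y h)) p - act Z (act Y (act X h)) p"
proof -
  have "act (br X Y) h = (\<lambda>q. act X (act Y h) q - act Y (act X h) q)"
    using assms by (auto simp: act_br)
  then show ?thesis
    using assms by (simp add: act_fdiff)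
qed

text \<open>With \<open>br\<close> defined through \<open>D\<close>, this is not a formal identity:
  torsion-freeness makes \<open>br\<close> the commutator of derivations, and faithfulness of the
  action carries the cancellation back to fields.\<close>

lemma jacobi:
  assumes [simp]: "X \<in> V" "Y \<in> V" "Z \<in> V"
  shows "br X (br Y Z) + br Y (br Z X) + br Z (br X Y) = 0"
  by (rule act_faithful) (simp_all add: act_vadd act_br act_act_br act_zero)

definition R :: "'v \<Rightarrow> 'v \<Rightarrow> 'v \<Rightarrow> 'v" where
  "R X Y Z = D X (D Y Z) - D Y (D X Z) - D (br X Y) Z"

lemma R_V [simp]: "X \<in> V \<Longrightarrow> Y \<in> V \<Longrightarrow> Z \<in> V \<Longrightarrow> R X Y Z \<in> V"
  by (simp add: R_def)

definition Rm :: "'v \<Rightarrow> 'v \<Rightarrow> 'v \<Rightarrow> 'v \<Rightarrow> 'p \<Rightarrow> real" where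
  "Rm X Y Z W p = ip (R X Y Z) W p"

lemma br_skew: "br X Y = - br Y X"
  by (simp add: br_def)

lemma Rm_skew12:
  assumes "X \<in> V" "Y \<in> V" "Z \<in> V" "W \<in> V"
  shows "Rm X Y Z W p = - Rm Y X Z W p"
  using assms by (simp add: Rm_def R_def br_skew[of X] D_uminus_left ip_simps)

text \<open>Differentiating g(Z,W) along X and Y in both orders and subtracting the derivative along
  the bracket gives zero; metricity turns this into the skew symmetry.\<close>

lemma Rm_skew34:
  assumes [simp]: "X \<in> V" "Y \<in> V" "Z \<in> V" "W \<in> V"
  shows "Rm X Y Z W p = - Rm X Y W Z p"
proof -
  have m: "act U (ip Z W) = (\<lambda>q. ip (D U Z) W q + ip Z (D U W) q)" if "U \<in> V" for U
    using that by (auto simp: metric)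
  have "act X (act Y (ip Z W)) p - act Y (act X (ip Z W)) p = act (br X Y) (ip Z W) p"
    by (simp add: act_br)
  then show ?thesis
    by (simp add: m act_add metric Rm_def R_def ip_simps ip_sym[of _ Z])
qed

lemma bianchi:
  assumes [simp]: "X \<in> V" "Y \<in> V" "Z \<in> V"
  shows "R X Y Z + R Y Z X + R Z X Y = 0"
proof -
  have "R X Y Z + R Y Z X + R Z X Y = br X (br Y Z) + br Y (br Z X) + br Z (br X Y)"
    by (simp add: R_def br_def D_diff_left D_diff_right algebra_simps)
  then show ?thesis by (simp add: jacobi)
qed

lemma Rm_bianchi:
  assumes [simp]: "X \<in> V" "Y \<in> V" "Z \<in> V" "W \<in> V"
  shows "Rm X Y Z W p + Rm Y Z X W p + Rm Z X Y W p = 0"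
proof -
  have "ip (R X Y Z + R Y Z X + R Z X Y) W p = 0"
    by (simp add: bianchi ip_zero_left)
  then show ?thesis by (simp add: Rm_def ip_simps)
qed

lemma Rm_pair:
  assumes [simp]: "X \<in> V" "Y \<in> V" "Z \<in> V" "W \<in> V"
  shows "Rm X Y Z W p = Rm Z W X Y p"
proof -
  note b = Rm_bianchi and s1 = Rm_skew12 and s2 = Rm_skew34
  show ?thesis
    using b[of X Y Z W p] b[of Y Z W X p] b[of Z W X Y p] b[of W X Y Z p]
      s2[of Y Z W X p] s2[of Z W Y X p] s1[of W Y Z X p] s1[of W X Z Y p] s2[of X W Z Y p]
      s1[of X Z W Y p] s2[of Z X W Y p] s1[of W X Y Z p] s2[of X Y W Z p] s2[of Y W X Z p]
    by simp
qed

lemma Rm_add1: "X \<in> V \<Longrightarrow> X' \<in> V \<Longrightarrow> Y \<in> V \<Longrightarrow> Z \<in> V \<Longrightarrow> W \<in> V \<Longrightarrow>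
    Rm (X + X') Y Z W p = Rm X Y Z W p + Rm X' Y Z W p"
  by (simp add: Rm_def R_def br_def D_add_left D_add_right D_diff_left ip_simps)

lemma Rm_add4: "X \<in> V \<Longrightarrow> X' \<in> V \<Longrightarrow> Y \<in> V \<Longrightarrow> Z \<in> V \<Longrightarrow> W \<in> V \<Longrightarrow>
    Rm Y Z W (X + X') p = Rm Y Z W X p + Rm Y Z W X' p"
  by (simp add: Rm_def ip_simps)

lemma Rm_add2: "X \<in> V \<Longrightarrow> X' \<in> V \<Longrightarrow> Y \<in> V \<Longrightarrow> Z \<in> V \<Longrightarrow> W \<in> V \<Longrightarrow>
    Rm Y (X + X') Z W p = Rm Y X Z W p + Rm Y X' Z W p"
  by (simp add: Rm_skew12[of Y] Rm_add1)

lemma Rm_add3: "X \<in> V \<Longrightarrow> X' \<in> V \<Longrightarrow> Y \<in> V \<Longrightarrow> Z \<in> V \<Longrightarrow> W \<in> V \<Longrightarrow>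
    Rm Y Z (X + X') W p = Rm Y Z X W p + Rm Y Z X' W p"
  by (simp add: Rm_skew34[of Y Z _ W] Rm_add4)

text \<open>Polarization scales by constants only. Function coefficients are expanded in the fourth
  slot, where \<open>Rm\<close> is an inner product.\<close>

lemma Rm_cmul1:
  assumes [simp]: "X \<in> V" "Y \<in> V" "Z \<in> V" "W \<in> V"
  shows "Rm (smul (\<lambda>_. r) X) Y Z W p = r * Rm X Y Z W p"
proof -
  have "br (smul (\<lambda>_. r) X) Y = smul (\<lambda>_. r) (br X Y)"
    by (rule ip_eqI) (simp_all add: br_def D_smul_left D_cmul_right ip_simps algebra_simps)
  then show ?thesis
    by (simp add: Rm_def R_def D_smul_left D_cmul_right ip_simps algebra_simps)
qed

lemma Rm_cmul4: "X \<in> V \<Longrightarrow> Y \<in> V \<Longrightarrow> Z \<in> V \<Longrightarrow> W \<in> V \<Longrightarrow>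
    Rm X Y Z (smul (\<lambda>_. r) W) p = r * Rm X Y Z W p"
  by (simp add: Rm_def ip_simps)

lemma Rm_cmul2: "X \<in> V \<Longrightarrow> Y \<in> V \<Longrightarrow> Z \<in> V \<Longrightarrow> W \<in> V \<Longrightarrow>
    Rm X (smul (\<lambda>_. r) Y) Z W p = r * Rm X Y Z W p"
  by (simp add: Rm_skew12[of X] Rm_cmul1)

lemma Rm_cmul3: "X \<in> V \<Longrightarrow> Y \<in> V \<Longrightarrow> Z \<in> V \<Longrightarrow> W \<in> V \<Longrightarrow>
    Rm X Y (smul (\<lambda>_. r) Z) W p = r * Rm X Y Z W p"
  by (simp add: Rm_skew34[of X Y _ W] Rm_cmul4)

lemmas Rm_simps = Rm_add1 Rm_add2 Rm_add3 Rm_add4 Rm_cmul1 Rm_cmul2 Rm_cmul3 Rm_cmul4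

end

section \<open>S-structures\<close>

text \<open>The forms eta^a are encoded as \<open>ip _ (\<xi> \<alpha>)\<close>, and
  \<open>normal\<close> has d eta^a already replaced by the fundamental form. Equations involving
  F^2 or the bracket are tested against an arbitrary field, so that they become scalar
  equations.\<close>

locale S_structure = lie_rinehart C V smul act ip D
  for C :: "('p \<Rightarrow> real) set"
    and V :: "'v::ab_group_add set"
    and smul :: "('p \<Rightarrow> real) \<Rightarrow> 'v \<Rightarrow> 'v"
    and act :: "'v \<Rightarrow> ('p \<Rightarrow> real) \<Rightarrow> 'p \<Rightarrow> real"
    and ip :: "'v \<Rightarrow> 'v \<Rightarrow> 'p \<Rightarrow> real"
    and D :: "'v \<Rightarrow> 'v \<Rightarrow> 'v" +
  fixes F :: "'v \<Rightarrow> 'v"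
    and \<xi> :: "'i \<Rightarrow> 'v"
    and I :: "'i set"
  assumes finite_I [simp]: "finite I"
    and I_nonempty: "I \<noteq> {}"
    and F_V [simp]: "X \<in> V \<Longrightarrow> F X \<in> V"
    and xi_V [simp]: "\<alpha> \<in> I \<Longrightarrow> \<xi> \<alpha> \<in> V"
    and F_add: "X \<in> V \<Longrightarrow> Y \<in> V \<Longrightarrow> F (X + Y) = F X + F Y"
    and F_smul: "h \<in> C \<Longrightarrow> X \<in> V \<Longrightarrow> F (smul h X) = smul h (F X)"
    and ip_F_F: "X \<in> V \<Longrightarrow> W \<in> V \<Longrightarrow>
      ip (F (F X)) W p = - ip X W p + (\<Sum>\<alpha>\<in>I. ip X (\<xi> \<alpha>) p * ip (\<xi> \<alpha>) W p)"
    and ip_xi_xi: "\<alpha> \<in> I \<Longrightarrow> \<beta> \<in> I \<Longrightarrow> ip (\<xi> \<alpha>) (\<xi> \<beta>) p = (if \<alpha> = \<beta> then 1 else 0)"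
    and F_xi: "\<alpha> \<in> I \<Longrightarrow> F (\<xi> \<alpha>) = 0"
    and F_skew: "X \<in> V \<Longrightarrow> Y \<in> V \<Longrightarrow> ip X (F Y) p = - ip (F X) Y p"
    and normal: "X \<in> V \<Longrightarrow> Y \<in> V \<Longrightarrow> W \<in> V \<Longrightarrow>
      ip (F (F (br X Y)) + br (F X) (F Y) - F (br (F X) Y) - F (br X (F Y))) W p
        = - 2 * ip X (F Y) p * (\<Sum>\<alpha>\<in>I. ip (\<xi> \<alpha>) W p)"
    and contact: "\<alpha> \<in> I \<Longrightarrow> X \<in> V \<Longrightarrow> Y \<in> V \<Longrightarrow>
      2 * ip X (F Y) p = act X (ip Y (\<xi> \<alpha>)) p - act Y (ip X (\<xi> \<alpha>)) p - ip (br X Y) (\<xi> \<alpha>) p"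
begin

section \<open>Algebra of the structure tensor\<close>

lemma F_uminus: "X \<in> V \<Longrightarrow> F (- X) = - F X"
  by (simp add: smul_uminus F_smul)

lemma F_zero: "F 0 = 0"
  using F_add[of 0 0] by simp

lemma F_diff: "X \<in> V \<Longrightarrow> Y \<in> V \<Longrightarrow> F (X - Y) = F X - F Y"
  using F_add[of "X - Y" Y] by simp

lemma ip_F_xi [simp]:
  assumes "\<alpha> \<in> I" "X \<in> V"
  shows "ip (F X) (\<xi> \<alpha>) p = 0" "ip (\<xi> \<alpha>) (F X) p = 0"
  using assms F_skew[of X "\<xi> \<alpha>" p] F_skew[of "\<xi> \<alpha>" X p] by (simp_all add: F_xi ip_simps)

lemma ip_F_move: "X \<in> V \<Longrightarrow> Y \<in> V \<Longrightarrow> ip (F X) Y p = - ip X (F Y) p"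
  by (simp add: F_skew)

lemma ip_F_F_F: "X \<in> V \<Longrightarrow> Y \<in> V \<Longrightarrow> ip (F (F (F X))) Y p = - ip (F X) Y p"
  by (simp add: ip_F_F)

lemma F_F_F: "X \<in> V \<Longrightarrow> F (F (F X)) = - F X"
  by (rule ip_eqI) (simp_all add: ip_F_F_F ip_simps)

lemma ip_F_self [simp]: "X \<in> V \<Longrightarrow> ip X (F X) p = 0"
  using F_skew[of X X p] ip_sym[of X "F X" p] by simp

definition xb :: 'v where
  "xb = (\<Sum>\<alpha>\<in>I. \<xi> \<alpha>)"

lemma xb_V [simp]: "xb \<in> V"
  unfolding xb_def by simp

lemma ip_xb: "W \<in> V \<Longrightarrow> ip xb W p = (\<Sum>\<alpha>\<in>I. ip (\<xi> \<alpha>) W p)"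
  unfolding xb_def by (rule ip_sum_left) auto

lemma ip_xb_F [simp]: "X \<in> V \<Longrightarrow> ip xb (F X) p = 0" "X \<in> V \<Longrightarrow> ip (F X) xb p = 0"
  by (simp_all add: ip_sym[of "F X" xb] ip_xb)

lemma ip_xb_xi [simp]: "\<alpha> \<in> I \<Longrightarrow> ip xb (\<xi> \<alpha>) p = 1"
  by (simp add: ip_xb ip_xi_xi)

lemma ip_xb_xb: "ip xb xb p = real (card I)"
proof -
  have "ip (\<xi> \<alpha>) xb p = 1" if "\<alpha> \<in> I" for \<alpha>
    using that ip_sym[of "\<xi> \<alpha>" xb p] by simp
  then show ?thesis
    using ip_xb[of xb p] by simp
qed

section \<open>Closedness of the fundamental form and the Killing property\<close>

text \<open>This is \<open>d(d\<eta>\<^sup>\<alpha>) = 0\<close>: the second derivatives cancel by the definition of the bracket,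
  the rest by the Jacobi identity.\<close>

lemma fundamental_form_closed:
  assumes [simp]: "X \<in> V" "Y \<in> V" "Z \<in> V"
  shows "act X (ip Y (F Z)) p + act Y (ip Z (F X)) p + act Z (ip X (F Y)) p
    = ip (br X Y) (F Z) p + ip (br Y Z) (F X) p + ip (br Z X) (F Y) p"
proof -
  \<comment> \<open>All eta^a have the same exterior derivative, so any one of them serves as a
    potential of the fundamental form.\<close>
  obtain \<alpha> where \<alpha> [simp]: "\<alpha> \<in> I" using I_nonempty by blast
  define e where "e W = ip W (\<xi> \<alpha>)" for W
  have eC [simp]: "W \<in> V \<Longrightarrow> e W \<in> C" for W by (simp add: e_def)
  have c: "ip U (F W) q = (1/2) * (act U (e W) q - act W (e U) q - e (br U W) q)"
    if "U \<in> V" "W \<in> V" for U W q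
    using contact[of \<alpha> U W q] that by (simp add: e_def)
  have act_c: "act T (ip U (F W)) p
      = (1/2) * (act T (act U (e W)) p - act T (act W (e U)) p - act T (e (br U W)) p)"
    if [simp]: "T \<in> V" "U \<in> V" "W \<in> V" for T U W
  proof -
    have "ip U (F W) = (\<lambda>q. (1/2) * (act U (e W) q - act W (e U) q - e (br U W) q))"
      by (auto simp: c)
    then show ?thesis
      by (simp add: act_cmul act_fdiff del: times_divide_eq_left divide_divide_eq_left mult_1 mult_1_left)
  qed
  have "e (br X (br Y Z) + br Y (br Z X) + br Z (br X Y)) p = 0"
    by (simp add: jacobi e_def ip_simps)
  then have j: "e (br X (br Y Z)) p + e (br Y (br Z X)) p + e (br Z (br X Y)) p = 0"
    by (simp add: e_def ip_simps)
  have sk: "e (br U W) p = - e (br W U) p" if "U \<in> V" "W \<in> V" for U W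
    using that by (simp add: e_def br_skew[of U] ip_simps)
  show ?thesis
    using j sk[of X "br Y Z"] sk[of Y "br Z X"] sk[of Z "br X Y"]
    by (simp add: act_c c act_br add_divide_distrib diff_divide_distrib)
qed

text \<open>The Lie derivative of F along xi_a vanishes. The difference U of the two sides has no
  vertical part, by \<open>contact\<close> at (F X, xi_a), and F U = 0, by \<open>normal\<close> at
  (X, xi_a), where F xi_a = 0 removes two of the brackets; then F^2 U = 0 leaves U = 0.\<close>

lemma br_F_xi:
  assumes [simp]: "\<alpha> \<in> I" "X \<in> V"
  shows "br (F X) (\<xi> \<alpha>) = F (br X (\<xi> \<alpha>))"
proof -
  have [simp]: "\<xi> \<alpha> \<in> V" by simp
  define U where "U = br (F X) (\<xi> \<alpha>) - F (br X (\<xi> \<alpha>))"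
  have U [simp]: "U \<in> V" by (simp add: U_def)
  have "ip U (\<xi> \<beta>) p = 0" if [simp]: "\<beta> \<in> I" for \<beta> p
  proof -
    have "ip (\<xi> \<alpha>) (\<xi> \<beta>) = (\<lambda>_. if \<alpha> = \<beta> then 1 else 0)" "ip (F X) (\<xi> \<beta>) = (\<lambda>_. 0)"
      by (auto simp: ip_xi_xi)
    then show ?thesis
      using contact[of \<beta> "F X" "\<xi> \<alpha>" p] by (simp add: F_xi ip_simps act_const U_def)
  qed
  moreover have "F U = 0"
  proof (rule ip_eqI)
    show "ip (F U) W p = ip 0 W p" if [simp]: "W \<in> V" for W p
    proof -
      have "br (F X) 0 = 0" "br X 0 = 0"
        by (simp_all add: br_def D_zero_left D_zero_right)
      then show ?thesis
        using normal[of X "\<xi> \<alpha>" W p] by (simp add: F_xi ip_simps F_zero U_def F_diff)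
    qed
  qed (auto)
  ultimately have "ip U W p = 0" if "W \<in> V" for W p
    using ip_F_F[of U W p] that by (simp add: F_zero ip_simps)
  then have "U = 0" by (intro ip_definite) auto
  then show ?thesis by (simp add: U_def)
qed

lemma ip_F_F': "X \<in> V \<Longrightarrow> Y \<in> V \<Longrightarrow>
    ip (F X) (F Y) p = ip X Y p - (\<Sum>\<alpha>\<in>I. ip X (\<xi> \<alpha>) p * ip Y (\<xi> \<alpha>) p)"
  using ip_F_F[of X Y p] by (simp add: F_skew[of "F X"] ip_sym[of _ Y])

text \<open>\<open>\<xi>\<^sub>\<alpha>\<close> preserves \<open>F\<close>, \<open>d\<eta>\<close> and all \<open>\<eta>\<^sup>\<beta>\<close>, and these determine the metric.\<close>

lemma xi_killing:
  assumes \<alpha> [simp]: "\<alpha> \<in> I" and [simp]: "X \<in> V" "Y \<in> V"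
  shows "ip (D X (\<xi> \<alpha>)) Y p + ip X (D Y (\<xi> \<alpha>)) p = 0"
proof -
  have [simp]: "\<xi> \<alpha> \<in> V" by simp
  have lie_eta: "act (\<xi> \<alpha>) (ip U (\<xi> \<beta>)) p = ip (br (\<xi> \<alpha>) U) (\<xi> \<beta>) p"
    if [simp]: "\<beta> \<in> I" "U \<in> V" for U \<beta>
  proof -
    have "ip (\<xi> \<alpha>) (\<xi> \<beta>) = (\<lambda>_. if \<alpha> = \<beta> then 1 else 0)"
      by (auto simp: ip_xi_xi)
    then show ?thesis
      using contact[of \<beta> "\<xi> \<alpha>" U p] by (simp add: F_xi act_const)
  qed
  \<comment> \<open>Closedness on (xi_a, F X, Y) is the vanishing of the Lie derivative of the
    fundamental form: the other two derivatives drop out because F xi_a = 0 and the image of F is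
    orthogonal to xi_a.\<close>
  have lie_P: "act (\<xi> \<alpha>) (ip (F X) (F Y)) p
      = ip (F (br (\<xi> \<alpha>) X)) (F Y) p + ip (F X) (F (br (\<xi> \<alpha>) Y)) p"
  proof -
    have z: "ip Y (F (\<xi> \<alpha>)) = (\<lambda>_. 0)" "ip (\<xi> \<alpha>) (F (F X)) = (\<lambda>_. 0)" "ip Y 0 = (\<lambda>_. 0)"
      by (auto simp: F_xi ip_simps)
    have "br (\<xi> \<alpha>) (F X) = F (br (\<xi> \<alpha>) X)"
      using br_F_xi[of \<alpha> X] by (simp add: br_skew[of "\<xi> \<alpha>"] F_uminus)
    moreover have "ip (\<xi> \<alpha>) (F U) = (\<lambda>_. 0)" if "U \<in> V" for U
      using that by auto
    ultimately show ?thesis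
      using fundamental_form_closed[of "\<xi> \<alpha>" "F X" Y p]
        F_skew[of "br Y (\<xi> \<alpha>)" "F X" p] ip_sym[of "F X" "F (br Y (\<xi> \<alpha>))" p]
      by (simp add: z F_xi ip_simps act_const br_skew[of "\<xi> \<alpha>" Y] F_uminus)
  qed
  have "ip X Y = (\<lambda>q. ip (F X) (F Y) q + (\<Sum>\<beta>\<in>I. ip X (\<xi> \<beta>) q * ip Y (\<xi> \<beta>) q))"
    by (auto simp: ip_F_F')
  then have "act (\<xi> \<alpha>) (ip X Y) p = act (\<xi> \<alpha>) (ip (F X) (F Y)) p
      + (\<Sum>\<beta>\<in>I. ip X (\<xi> \<beta>) p * act (\<xi> \<alpha>) (ip Y (\<xi> \<beta>)) p
          + ip Y (\<xi> \<beta>) p * act (\<xi> \<alpha>) (ip X (\<xi> \<beta>)) p)"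
    by (simp add: act_add act_sum act_mult)
  also have "\<dots> = ip (br (\<xi> \<alpha>) X) Y p + ip X (br (\<xi> \<alpha>) Y) p"
    by (simp add: lie_P lie_eta ip_F_F' sum.distrib algebra_simps)
  finally show ?thesis
    by (simp add: metric br_def ip_simps)
qed

text \<open>\<open>contact\<close> determines the skew part of nabla xi_a, and the Killing equation
  says that the symmetric part is zero.\<close>

lemma D_xi:
  assumes \<alpha> [simp]: "\<alpha> \<in> I" and [simp]: "X \<in> V"
  shows "D X (\<xi> \<alpha>) = - F X"
proof (rule ip_eqI)
  have [simp]: "\<xi> \<alpha> \<in> V" by simp
  fix Y p assume [simp]: "Y \<in> V"
  show "ip (D X (\<xi> \<alpha>)) Y p = ip (- F X) Y p"
    using contact[of \<alpha> X Y p] xi_killing[of \<alpha> X Y p]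
    by (simp add: metric br_def ip_simps ip_F_move ip_sym[of Y])
qed auto

lemma D_xb: "X \<in> V \<Longrightarrow> D X xb = smul (\<lambda>_. - real (card I)) (F X)"
  by (rule ip_eqI) (simp_all add: xb_def D_sum_right D_xi ip_simps)

subsection \<open>The covariant derivative of the structure tensor\<close>

definition cov_F :: "'v \<Rightarrow> 'v \<Rightarrow> 'v" where
  "cov_F X Y = D X (F Y) - F (D X Y)"

lemma cov_F_V [simp]: "X \<in> V \<Longrightarrow> Y \<in> V \<Longrightarrow> cov_F X Y \<in> V"
  by (simp add: cov_F_def)

text \<open>The deviation of \<open>cov_F\<close> from its value on an S-manifold. It satisfies the same identities as
  \<open>cov_F\<close> on an almost Hermitian manifold with integrable structure and closed fundamental form.\<close>

definition dev :: "'v \<Rightarrow> 'v \<Rightarrow> 'v \<Rightarrow> 'p \<Rightarrow> real" where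
  "dev X Y Z p = ip (cov_F X Y) Z p
     - (ip (F X) (F Y) p * ip xb Z p + ip xb Y p * ip (F (F X)) Z p)"

lemma ip_FF_sym: "X \<in> V \<Longrightarrow> Y \<in> V \<Longrightarrow> ip (F (F X)) Y p = - ip (F X) (F Y) p"
  by (simp add: F_skew)

text \<open>F is skew and the metric parallel, so nabla_X F is skew; the subtracted model term is
  skew as well.\<close>

lemma dev_skew:
  assumes [simp]: "X \<in> V" "Y \<in> V" "Z \<in> V"
  shows "dev X Y Z p = - dev X Z Y p"
proof -
  have "ip Y (F Z) = (\<lambda>q. (-1) * ip (F Y) Z q)"
    by (auto simp: F_skew)
  then have "act X (ip Y (F Z)) p = - act X (ip (F Y) Z) p"
    using act_cmul[of X "ip (F Y) Z" "-1" p] by simp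
  then have "ip (cov_F X Y) Z p = - ip (cov_F X Z) Y p"
    by (simp add: metric cov_F_def ip_simps ip_F_move ip_sym[of _ Y])
  then show ?thesis
    by (simp add: dev_def ip_FF_sym ip_sym[of "F Z"])
qed

text \<open>Closedness of the fundamental form with brackets written through the torsion-free
  \<open>D\<close>. The model terms cancel in the cyclic sum.\<close>

lemma dev_cyclic:
  assumes [simp]: "X \<in> V" "Y \<in> V" "Z \<in> V"
  shows "dev X Y Z p + dev Y Z X p + dev Z X Y p = 0"
proof -
  have cov: "ip U (cov_F T W) p = act T (ip U (F W)) p - ip (D T U) (F W) p + ip (D T W) (F U) p"
    if [simp]: "T \<in> V" "U \<in> V" "W \<in> V" for T U W
  proof -
    have "ip U (F (D T W)) p = - ip (D T W) (F U) p"
      using F_skew[of U "D T W" p] ip_sym[of "F U" "D T W" p] by simp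
    then show ?thesis by (simp add: cov_F_def metric ip_simps)
  qed
  have "ip Y (cov_F X Z) p + ip Z (cov_F Y X) p + ip X (cov_F Z Y) p = 0"
    using fundamental_form_closed[of X Y Z p] by (simp add: cov br_def ip_simps)
  moreover have "dev T W U p = ip U (cov_F T W) p
      - (ip (F T) (F W) p * ip xb U p - ip xb W p * ip (F T) (F U) p)"
    if [simp]: "T \<in> V" "U \<in> V" "W \<in> V" for T U W
    using ip_sym[of U "cov_F T W" p] by (simp add: dev_def ip_FF_sym)
  moreover have "ip (F Z) (F X) p = ip (F X) (F Z) p" "ip (F Z) (F Y) p = ip (F Y) (F Z) p"
    "ip (F Y) (F X) p = ip (F X) (F Y) p"
    by (simp_all add: ip_sym)
  ultimately have "dev X Z Y p + dev Y X Z p + dev Z Y X p = 0"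
    by simp
  then show ?thesis
    using dev_skew[of X Y Z p] dev_skew[of Y Z X p] dev_skew[of Z X Y p] by simp
qed


text \<open>Origin of the term eta(Y) F^2 X in the model: it is forced by nabla_X xi_a = -F X, and
  fits each xi_a separately since eta(xi_a) = 1.\<close>

lemma cov_F_xi:
  assumes [simp]: "\<alpha> \<in> I" "X \<in> V"
  shows "cov_F X (\<xi> \<alpha>) = F (F X)"
  by (simp add: cov_F_def F_xi D_xi D_zero_right F_uminus)

lemma dev_xi2 [simp]: "\<alpha> \<in> I \<Longrightarrow> X \<in> V \<Longrightarrow> Y \<in> V \<Longrightarrow> dev X (\<xi> \<alpha>) Y p = 0"
  by (simp add: dev_def cov_F_xi F_xi ip_simps)

lemma dev_xi3 [simp]: "\<alpha> \<in> I \<Longrightarrow> X \<in> V \<Longrightarrow> Y \<in> V \<Longrightarrow> dev X Y (\<xi> \<alpha>) p = 0"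
  by (simp add: dev_skew[of X Y])

lemma dev_FF3:
  assumes [simp]: "X \<in> V" "Y \<in> V" "Z \<in> V"
  shows "dev X Y (F (F Z)) p = - dev X Y Z p"
proof -
  have ff: "ip U (F (F Z)) p = - ip U Z p + (\<Sum>\<alpha>\<in>I. ip Z (\<xi> \<alpha>) p * ip U (\<xi> \<alpha>) p)"
    if "U \<in> V" for U
    using that by (simp add: ip_sym[of U "F (F Z)"] ip_F_F ip_sym[of Z U] ip_sym[of "\<xi> _" U])
  have "dev X Y (F (F Z)) p = - dev X Y Z p + (\<Sum>\<alpha>\<in>I. ip Z (\<xi> \<alpha>) p * dev X Y (\<xi> \<alpha>) p)"
    unfolding dev_def
    by (simp add: ff ring_distribs sum.distrib sum_subtractf sum_negf sum_distrib_left sum_distrib_right ac_simps)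
  then show ?thesis by simp
qed

text \<open>Differentiating F^2 = -I + (sum of eta^a tensor xi_a) shows that nabla_X F anticommutes
  with F up to terms from nabla eta^a and nabla xi_a, which the model absorbs; F then moves across
  because it is skew.\<close>

lemma dev_F2:
  assumes [simp]: "X \<in> V" "Y \<in> V" "Z \<in> V"
  shows "dev X (F Y) Z p = dev X Y (F Z) p"
proof -
  have FF: "F (F Y) = (\<Sum>\<alpha>\<in>I. smul (ip Y (\<xi> \<alpha>)) (\<xi> \<alpha>)) - Y"
    by (rule ip_eqI) (simp_all add: ip_F_F ip_simps)
  have act_eta: "act X (ip Y (\<xi> \<alpha>)) p = ip (D X Y) (\<xi> \<alpha>) p - ip Y (F X) p" if "\<alpha> \<in> I" for \<alpha>
    using that by (simp add: metric D_xi ip_simps)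
  have "ip (D X (F (F Y))) Z p = - ip (D X Y) Z p +
      (\<Sum>\<alpha>\<in>I. act X (ip Y (\<xi> \<alpha>)) p * ip (\<xi> \<alpha>) Z p - ip Y (\<xi> \<alpha>) p * ip (F X) Z p)"
    by (simp add: FF D_diff_right D_sum_right D_smul_right D_xi ip_simps)
  also have "\<dots> = ip (F (F (D X Y))) Z p - ip Y (F X) p * ip xb Z p - ip xb Y p * ip (F X) Z p"
    by (simp add: act_eta ip_F_F ip_xb ip_sym[of Y "\<xi> _"] algebra_simps sum.distrib sum_subtractf sum_distrib_left)
  finally have "ip (cov_F X (F Y)) Z p + ip (F (cov_F X Y)) Z p
      = - ip Y (F X) p * ip xb Z p - ip xb Y p * ip (F X) Z p"
    by (simp add: cov_F_def F_diff ip_simps)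
  moreover have "ip (F (cov_F X Y)) Z p = - ip (cov_F X Y) (F Z) p"
    by (simp add: ip_F_move)
  moreover have "ip (F (F X)) (F Z) p = ip (F X) Z p"
    using ip_F_F_F[of X Z p] by (simp add: F_skew)
  moreover have "ip (F X) (F (F Y)) p = - ip Y (F X) p"
    using ip_F_F_F[of X Y p] ip_sym[of "F X" Y p] by (simp add: F_skew)
  ultimately show ?thesis
    by (simp add: dev_def)
qed

text \<open>For a torsion-free connection the Nijenhuis tensor is an expression in nabla F alone.
  The model contributes exactly the -2 g(X,FY) xi of the normality condition, so only
  \<open>dev\<close> remains.\<close>

lemma dev_normal:
  assumes [simp]: "X \<in> V" "Y \<in> V" "Z \<in> V"
  shows "dev (F X) Y Z p - dev (F Y) X Z p = - dev X Y (F Z) p + dev Y X (F Z) p"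
proof -
  have "F (F (br X Y)) + br (F X) (F Y) - F (br (F X) Y) - F (br X (F Y))
      = cov_F (F X) Y - cov_F (F Y) X - F (cov_F X Y) + F (cov_F Y X)"
    by (simp add: cov_F_def br_def F_diff)
  then have "ip (cov_F (F X) Y - cov_F (F Y) X - F (cov_F X Y) + F (cov_F Y X)) Z p
      = - 2 * ip X (F Y) p * ip xb Z p"
    using normal[of X Y Z p] by (simp add: ip_xb)
  moreover have "ip (F (cov_F X Y)) Z p = - ip (cov_F X Y) (F Z) p"
    "ip (F (cov_F Y X)) Z p = - ip (cov_F Y X) (F Z) p"
    by (simp_all add: ip_F_move)
  moreover have "ip (F (F X)) (F W) p = ip (F X) W p" "ip (F (F (F X))) W p = - ip (F X) W p"
    "ip (F (F Y)) (F W) p = ip (F Y) W p" "ip (F (F (F Y))) W p = - ip (F Y) W p" if "W \<in> V" for W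
    using ip_F_F_F[of X W p] ip_F_F_F[of Y W p] that by (simp_all add: F_skew)
  moreover have "ip (F X) Y p = - ip X (F Y) p" "ip (F Y) X p = ip X (F Y) p"
    using ip_F_move[of X Y p] ip_sym[of "F Y" X p] by simp_all
  ultimately show ?thesis
    by (simp add: dev_def ip_simps)
qed

text \<open>With \<open>a, b, c\<close> the cyclic permutations of \<open>dev (F X) Y Z\<close>, the previous identities give
  \<open>a + b = c\<close>, \<open>b + c = a\<close> and \<open>c + a = b\<close>.\<close>

lemma dev_F1:
  assumes [simp]: "X \<in> V" "Y \<in> V" "Z \<in> V"
  shows "dev (F X) Y Z p = 0"
proof -
  \<comment> \<open>Skew symmetry makes the left side of \<open>dev_normal\<close> a sum of two
    cyclic permutations; the cyclic identity collapses its right side to the third.\<close>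
  have "dev (F U) T W p + dev (F T) W U p = dev (F W) U T p"
    if [simp]: "U \<in> V" "T \<in> V" "W \<in> V" for U T W
    using dev_normal[of U T W p] dev_cyclic[of U T "F W" p] dev_skew[of T U "F W" p]
      dev_skew[of "F T" U W p]
    by simp
  from this[of X Y Z] this[of Y Z X] this[of Z X Y] show ?thesis by simp
qed

text \<open>\<open>dev_F1\<close> covers only first arguments in the image of F. Normality at (X, F
  Y) extends it to \<open>dev X (F Y) (F Z)\<close>, and both F can be gathered in the last slot,
  where F^2 acts as -1.\<close>

lemma dev_zero:
  assumes [simp]: "X \<in> V" "Y \<in> V" "Z \<in> V"
  shows "dev X Y Z p = 0"
proof -
  have "dev X (F Y) (F Z) p = dev (F Y) X (F Z) p"
    using dev_normal[of X "F Y" Z p] dev_F1[of X "F Y" Z p] dev_F1[of "F Y" X Z p]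
      dev_F1[of "F Y" X "F Z" p]
     by (simp add: dev_F1)
  then have "dev X Y (F (F Z)) p = 0"
    by (simp add: dev_F1 dev_F2)
  then show ?thesis by (simp add: dev_FF3)
qed

lemma D_F:
  assumes [simp]: "X \<in> V" "Z \<in> V"
  shows "D X (F Z) = F (D X Z) + smul (ip (F X) (F Z)) xb + smul (ip xb Z) (F (F X))"
proof (rule ip_eqI)
  fix W p assume [simp]: "W \<in> V"
  show "ip (D X (F Z)) W p
      = ip (F (D X Z) + smul (ip (F X) (F Z)) xb + smul (ip xb Z) (F (F X))) W p"
    using dev_zero[of X Z W p] by (simp add: dev_def cov_F_def ip_simps)
qed auto

subsection \<open>Curvature\<close>

text \<open>As nabla xi_a = -F, this curvature is the skew part of nabla F; the multiples of
  \<open>xb\<close> cancel by symmetry, and the result is the same for every index.\<close>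

lemma Rm_xi:
  assumes [simp]: "\<alpha> \<in> I" "X \<in> V" "Y \<in> V" "W \<in> V"
  shows "Rm X Y (\<xi> \<alpha>) W p = ip xb Y p * ip (F X) (F W) p - ip xb X p * ip (F Y) (F W) p"
proof -
  have "R X Y (\<xi> \<alpha>) = D Y (F X) - D X (F Y) + F (br X Y)"
    by (simp add: R_def D_xi D_uminus_right)
  also have "\<dots> = smul (ip (F Y) (F X)) xb + smul (ip xb X) (F (F Y))
      - smul (ip (F X) (F Y)) xb - smul (ip xb Y) (F (F X))"
    by (simp add: D_F br_def F_diff)
  finally show ?thesis
    by (simp add: Rm_def ip_simps ip_FF_sym ip_sym[of "F Y" "F X"])
qed

lemma Rm_xi4:
  assumes [simp]: "\<alpha> \<in> I" "X \<in> V" "Y \<in> V" "Z \<in> V"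
  shows "Rm X Y Z (\<xi> \<alpha>) p = ip xb X p * ip (F Y) (F Z) p - ip xb Y p * ip (F X) (F Z) p"
  using Rm_skew34[of X Y Z "\<xi> \<alpha>" p] by (simp add: Rm_xi)

text \<open>Horizontal at every point and not just at p, because \<open>Rm_F\<close> differentiates
  the condition.\<close>

definition hor :: "'v \<Rightarrow> bool" where
  "hor X \<longleftrightarrow> X \<in> V \<and> (\<forall>\<alpha>\<in>I. \<forall>p. ip X (\<xi> \<alpha>) p = 0)"

lemma hor_V: "hor X \<Longrightarrow> X \<in> V"
  by (simp add: hor_def)

lemma hor_xi: "hor X \<Longrightarrow> \<alpha> \<in> I \<Longrightarrow> ip X (\<xi> \<alpha>) p = 0"
  by (simp add: hor_def)

lemma hor_add: "hor X \<Longrightarrow> hor Y \<Longrightarrow> hor (X + Y)"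
  by (simp add: hor_def ip_simps)

lemma hor_smul: "hor X \<Longrightarrow> h \<in> C \<Longrightarrow> hor (smul h X)"
  by (simp add: hor_def ip_simps)

lemma hor_F: "X \<in> V \<Longrightarrow> hor (F X)"
  by (simp add: hor_def)

lemma hor_xb: "hor X \<Longrightarrow> ip xb X p = 0"
  by (simp add: ip_xb ip_sym[of "\<xi> _" X] hor_V hor_xi)

lemma hor_FF:
  assumes "hor X"
  shows "F (F X) = - X"
  using assms by (intro ip_eqI) (simp_all add: ip_F_F ip_simps hor_V hor_xi)

lemma hor_ip_F_F: "hor X \<Longrightarrow> Y \<in> V \<Longrightarrow> ip (F X) (F Y) p = ip X Y p"
  by (simp add: ip_F_F' hor_V hor_xi)

text \<open>The commutator of R(X,Y) with F. The factor s has two sources, both from nabla xi = -s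
  F: the derivative of \<open>xb\<close> in nabla F, and the vertical part of
  \<open>D T Z\<close>.\<close>

lemma Rm_F:
  assumes "hor X" "hor Y" "hor Z" "hor W"
  shows "Rm X Y (F Z) W p + Rm X Y Z (F W) p = real (card I) *
    (ip X Z p * ip (F Y) W p + ip (F X) Z p * ip Y W p - ip Y Z p * ip (F X) W p - ip (F Y) Z p * ip X W p)"
proof -
  note [simp] = hor_V[OF assms(1)] hor_V[OF assms(2)] hor_V[OF assms(3)] hor_V[OF assms(4)]
  have DD: "ip (D U (D T (F Z))) W p = ip (F (D U (D T Z))) W p
      - real (card I) * (ip T Z p * ip (F U) W p + ip (F T) Z p * ip U W p)"
    if U: "hor U" and T: "hor T" for U T
  proof -
    note [simp] = hor_V[OF U] hor_V[OF T]
    have "D T (F Z) = F (D T Z) + smul (ip T Z) xb"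
      by (rule ip_eqI) (simp_all add: D_F ip_simps hor_xb assms hor_ip_F_F T)
    moreover have "ip xb W p = 0" "ip (F (F U)) W p = - ip U W p"
      using assms U by (simp_all add: hor_xb hor_FF ip_simps)
    \<comment> \<open>\<open>D T Z\<close> leaves the horizontal distribution; its component along
      \<open>xb\<close> comes from differentiating eta(Z) = 0.\<close>
    moreover have "ip xb (D T Z) p = real (card I) * ip (F T) Z p"
    proof -
      have "ip xb Z = (\<lambda>_. 0)" using assms by (auto simp: hor_xb)
      then have "act T (ip xb Z) p = 0" by (simp add: act_const)
      then show ?thesis by (simp add: metric D_xb ip_simps)
    qed
    ultimately show ?thesis
      by (simp add: D_add_right D_smul_right D_F D_xb ip_simps algebra_simps)
  qed
  have "ip (D (br X Y) (F Z)) W p = ip (F (D (br X Y) Z)) W p"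
    using assms by (simp add: D_F ip_simps hor_xb)
  moreover have "Rm X Y Z (F W) p = - ip (F (R X Y Z)) W p"
    by (simp add: Rm_def F_skew)
  moreover have "ip (F (R X Y Z)) W p
      = ip (F (D X (D Y Z))) W p - ip (F (D Y (D X Z))) W p - ip (F (D (br X Y) Z)) W p"
    by (simp add: R_def F_diff ip_simps)
  moreover have "Rm X Y (F Z) W p
      = ip (D X (D Y (F Z))) W p - ip (D Y (D X (F Z))) W p - ip (D (br X Y) (F Z)) W p"
    by (simp add: Rm_def R_def ip_simps)
  ultimately show ?thesis
    using DD[OF assms(1,2)] DD[OF assms(2,1)] by (simp add: algebra_simps)
qed

text \<open>\<open>ip_definite\<close> concerns fields null at all points. Nullity at p alone is
  handled by the discriminant argument: t minimizes |X + t Z|^2 at p.\<close>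

lemma cauchy_schwarz_null:
  assumes [simp]: "X \<in> V" "Z \<in> V" and "ip X X p = 0" "ip Z Z p > 0"
  shows "ip X Z p = 0"
proof -
  define t where "t = - ip X Z p / ip Z Z p"
  have "ip (X + smul (\<lambda>_. t) Z) (X + smul (\<lambda>_. t) Z) p \<ge> 0"
    by (intro ip_nonneg) auto
  then have "2 * t * ip X Z p + t * t * ip Z Z p \<ge> 0"
    using assms by (simp add: ip_simps ip_sym[of Z X] algebra_simps)
  also have "2 * t * ip X Z p + t * t * ip Z Z p = - (ip X Z p)\<^sup>2 / ip Z Z p"
    using assms by (simp add: t_def field_simps power2_eq_square)
  finally show ?thesis
    using assms by (simp add: divide_le_0_iff zero_le_divide_iff)
qed

section \<open>Horizontal sectional curvature from the quartic\<close>

text \<open>The hypothesis on unit vectors says nothing about fields vanishing at \<open>p\<close>; for those the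
  quartic is evaluated along \<open>X + t Z\<close> with \<open>Z\<close> nonzero at \<open>p\<close>.\<close>

lemma f_sectional_quartic:
  assumes const: "\<And>X. hor X \<Longrightarrow> ip X X p = 1 \<Longrightarrow> Rm X (F X) (F X) X p = c"
    and Z: "hor Z" "ip Z Z p > 0" and X: "hor X"
  shows "Rm X (F X) (F X) X p = c * (ip X X p)\<^sup>2"
proof -
  note [simp] = hor_V[OF X] hor_V[OF Z(1)]
  have pos: "Rm U (F U) (F U) U p = c * (ip U U p)\<^sup>2" if U: "hor U" "ip U U p > 0" for U
  proof -
    note [simp] = hor_V[OF U(1)]
    \<comment> \<open>A constant factor making U a unit vector at p; the hypothesis asks for no
      more.\<close>
    define r where "r = 1 / sqrt (ip U U p)"
    have r: "r * r * ip U U p = 1" "r * r \<noteq> 0"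
      using U by (auto simp: r_def field_simps)
    have "Rm (smul (\<lambda>_. r) U) (F (smul (\<lambda>_. r) U)) (F (smul (\<lambda>_. r) U)) (smul (\<lambda>_. r) U) p = c"
      by (rule const) (use U r in \<open>auto intro: hor_smul simp: ip_simps ac_simps\<close>)
    then have "(r * r) * (r * r) * Rm U (F U) (F U) U p = c"
      by (simp add: F_smul Rm_simps ac_simps)
    also have "c = (r * r) * (r * r) * (c * (ip U U p)\<^sup>2)"
      using arg_cong[OF r(1), of "\<lambda>x. c * x * x"] by (simp add: power2_eq_square ac_simps)
    finally show ?thesis using r by simp
  qed
  show ?thesis
  proof (cases "ip X X p = 0")
    case False
    then show ?thesis using pos[OF X] ip_nonneg[of X p] by simp
  next
    case True
    then have XZ: "ip X Z p = 0" "ip Z X p = 0"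
      using cauchy_schwarz_null[of X Z p] Z ip_sym[of Z X p] by auto
    define q where "q t = Rm (X + smul (\<lambda>_. t) Z) (F (X + smul (\<lambda>_. t) Z))
        (F (X + smul (\<lambda>_. t) Z)) (X + smul (\<lambda>_. t) Z) p" for t
    have q: "q t = c * (t * t * ip Z Z p)\<^sup>2" if "t \<noteq> 0" for t
    proof -
      have "ip (X + smul (\<lambda>_. t) Z) (X + smul (\<lambda>_. t) Z) p = t * t * ip Z Z p"
        using True XZ by (simp add: ip_simps)
      moreover have "t * t * ip Z Z p > 0"
        using that Z by (metis mult_pos_pos not_real_square_gt_zero)
      ultimately show ?thesis
        unfolding q_def using pos[of "X + smul (\<lambda>_. t) Z"] X Z by (simp add: hor_add hor_smul)
    qed
    have "q t = Rm X (F X) (F X) X p + t * (Rm Z (F X) (F X) X p + Rm X (F Z) (F X) X p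
         + Rm X (F X) (F Z) X p + Rm X (F X) (F X) Z p)
       + t ^ 2 * (Rm Z (F Z) (F X) X p + Rm Z (F X) (F Z) X p + Rm Z (F X) (F X) Z p
         + Rm X (F Z) (F Z) X p + Rm X (F Z) (F X) Z p + Rm X (F X) (F Z) Z p)
       + t ^ 3 * (Rm X (F Z) (F Z) Z p + Rm Z (F X) (F Z) Z p + Rm Z (F Z) (F X) Z p + Rm Z (F Z) (F Z) X p)
       + t ^ 4 * Rm Z (F Z) (F Z) Z p" for t
      unfolding q_def
      by (simp add: F_add F_smul Rm_simps algebra_simps power2_eq_square power3_eq_cube power4_eq_xxxx)
    \<comment> \<open>The coefficient of t^4 is c |Z|^4 and q t equals c t^4 |Z|^4 for nonzero t, so
      the remaining cubic vanishes at four points and its constant term is zero.\<close>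
    from this[of 1] this[of "-1"] this[of 2] this[of "-2"] q[of 1] q[of "-1"] q[of 2] q[of "-2"] pos[OF Z]
    have "Rm X (F X) (F X) X p = 0"
      by (simp add: power_mult_distrib)
    then show ?thesis using True by simp
  qed
qed

text \<open>Coefficient of t^2 in the quartic along X + t Y. Adding the values at t = 1 and t = -1
  removes the odd powers, and the outer coefficients are known from X and Y alone.\<close>

lemma f_sectional_polarized:
  assumes B: "\<And>X. hor X \<Longrightarrow> Rm X (F X) (F X) X p = c * (ip X X p)\<^sup>2"
    and X: "hor X" and Y: "hor Y"
  shows "Rm X (F X) (F Y) Y p + Rm X (F Y) (F X) Y p + Rm X (F Y) (F Y) X p
      + Rm Y (F X) (F X) Y p + Rm Y (F X) (F Y) X p + Rm Y (F Y) (F X) X p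
    = c * (2 * ip X X p * ip Y Y p + 4 * (ip X Y p)\<^sup>2)"
proof -
  note [simp] = hor_V[OF X] hor_V[OF Y]
  have e: "c * (ip X X p + t * (2 * ip X Y p) + t\<^sup>2 * ip Y Y p)\<^sup>2 = Rm X (F X) (F X) X p
       + t * (Rm Y (F X) (F X) X p + Rm X (F Y) (F X) X p
         + Rm X (F X) (F Y) X p + Rm X (F X) (F X) Y p)
       + t ^ 2 * (Rm Y (F Y) (F X) X p + Rm Y (F X) (F Y) X p + Rm Y (F X) (F X) Y p
         + Rm X (F Y) (F Y) X p + Rm X (F Y) (F X) Y p + Rm X (F X) (F Y) Y p)
       + t ^ 3 * (Rm X (F Y) (F Y) Y p + Rm Y (F X) (F Y) Y p + Rm Y (F Y) (F X) Y p + Rm Y (F Y) (F Y) X p)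
       + t ^ 4 * Rm Y (F Y) (F Y) Y p" for t
  proof -
    have "ip (X + smul (\<lambda>_. t) Y) (X + smul (\<lambda>_. t) Y) p
        = ip X X p + t * (2 * ip X Y p) + t\<^sup>2 * ip Y Y p"
      by (simp add: ip_simps ip_sym[of Y X] power2_eq_square algebra_simps)
    moreover have "hor (X + smul (\<lambda>_. t) Y)"
      using X Y by (simp add: hor_add hor_smul)
    ultimately show ?thesis
      using B[of "X + smul (\<lambda>_. t) Y"]
      by (simp add: F_add F_smul Rm_simps algebra_simps power2_eq_square power3_eq_cube power4_eq_xxxx)
  qed
  from e[of 1] e[of "-1"] B[OF X] B[OF Y] show ?thesis
    by (simp add: power2_eq_square algebra_simps)
qed

text \<open>As on a Kaehler manifold, the identities for \<open>(X, Y)\<close> and \<open>(X, F Y)\<close> form a linear system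
  for the sectional curvatures of the planes spanned by \<open>X, Y\<close> and by \<open>X, F Y\<close>.\<close>

lemma horizontal_sectional_curvature:
  assumes B: "\<And>X. hor X \<Longrightarrow> Rm X (F X) (F X) X p = c * (ip X X p)\<^sup>2"
    and X: "hor X" and Y: "hor Y"
  shows "Rm X Y Y X p = (c + 3 * real (card I)) / 4 * (ip X X p * ip Y Y p - (ip X Y p)\<^sup>2)
    + 3 * (c - real (card I)) / 4 * (ip X (F Y) p)\<^sup>2"
proof -
  note [simp] = hor_V[OF X]
  define s where "s = real (card I)"
  have K: "Rm X Y Y X p + 3 * Rm X (F Y) (F Y) X p = (c + 3 * s) * ip X X p * ip Y Y p
      + (2 * c - 3 * s) * (ip X Y p)\<^sup>2 - 3 * s * (ip X (F Y) p)\<^sup>2"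
    if Y: "hor Y" for Y
  proof -
    note [simp] = hor_V[OF Y]
    note hF = hor_F[of X] hor_F[of Y]
    have ips: "ip (F X) Y p = - ip X (F Y) p" "ip (F Y) X p = ip X (F Y) p" "ip Y X p = ip X Y p"
      "ip Y (F X) p = - ip X (F Y) p" "ip (F X) (F Y) p = ip X Y p" "ip (F Y) (F X) p = ip X Y p"
      "ip (F X) (F X) p = ip X X p" "ip (F Y) (F Y) p = ip Y Y p"
      using F_skew[of X Y p] F_skew[of Y X p] ip_sym[of Y X p] ip_sym[of "F Y" X p]
        ip_sym[of "F Y" "F X" p] X Y
      by (simp_all add: hor_ip_F_F hor_FF ip_uminus_left)
    have FF: "ip (F (F Y)) U p = - ip Y U p" "ip (F (F X)) U p = - ip X U p" if "U \<in> V" for U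
      using X Y that by (simp_all add: hor_FF ip_uminus_left)
    have s0: "ip X (F X) p = 0" "ip Y (F Y) p = 0" "ip (F X) X p = 0" "ip (F Y) Y p = 0"
      using ip_sym[of "F X" X p] ip_sym[of "F Y" Y p] by simp_all
    \<comment> \<open>The commutator with F reduces the mixed terms of the polarized identity to
      sectional ones: \<open>c1\<close> and \<open>c2\<close> treat the planes of Y, F X and X, F Y,
      while \<open>c3\<close> with the Bianchi identity brings in the plane of X, Y.\<close>
    have c1: "Rm Y (F X) (F X) Y p + Rm Y (F X) X (F Y) p
        = s * (ip X Y p * - ip X Y p + ip X (F Y) p * - ip X (F Y) p - 0 - - ip X X p * ip Y Y p)"
      using Rm_F[of Y "F X" X Y p] X Y hF by (simp add: s_def ips FF s0)
    have c2: "Rm X (F Y) (F Y) X p + Rm X (F Y) Y (F X) p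
        = s * (- ip X Y p * ip X Y p - ip X (F Y) p * ip X (F Y) p + ip Y Y p * ip X X p)"
      using Rm_F[of X "F Y" Y X p] X Y hF by (simp add: s_def ips FF s0)
    have c3: "Rm X Y (F X) (F Y) p + Rm X Y X (F (F Y)) p
        = s * (ip X X p * ip Y Y p - ip X Y p * ip X Y p - ip X (F Y) p * ip X (F Y) p)"
      using Rm_F[of X Y X "F Y" p] X Y hF by (simp add: s_def ips FF s0)
    have c3': "Rm X Y X (F (F Y)) p = Rm X Y Y X p"
      using Rm_skew34[of X Y X Y p] Y by (simp add: hor_FF smul_uminus Rm_cmul4)
    show ?thesis
      using f_sectional_polarized[OF B X Y] c1 c2 c3 c3'
        Rm_pair[of X "F X" "F Y" Y p] Rm_skew12[of "F Y" Y X "F X" p] Rm_skew34[of Y "F Y" X "F X" p]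
        Rm_pair[of X "F Y" "F X" Y p] Rm_skew12[of "F X" Y X "F Y" p] Rm_skew34[of Y "F X" X "F Y" p]
        Rm_skew34[of X "F Y" Y "F X" p] Rm_bianchi[of X "F X" "F Y" Y p]
        Rm_pair[of "F X" "F Y" X Y p] Rm_skew12[of "F Y" X "F X" Y p]
      by (simp add: power2_eq_square algebra_simps)
  qed
  note [simp] = hor_V[OF Y]
  have "ip X (F (F Y)) p = - ip X Y p" "ip (F Y) (F Y) p = ip Y Y p"
     "Rm X (F (F Y)) (F (F Y)) X p = Rm X Y Y X p"
    using Y by (simp_all add: hor_FF hor_ip_F_F ip_uminus_right) (simp add: smul_uminus Rm_simps)
  \<comment> \<open>Since F^2 Y = -Y, the second equation has the two unknowns exchanged; three
    times it minus the first isolates 8 \<open>Rm X Y Y X p\<close>.\<close>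
  with K[OF Y] K[OF hor_F, of Y] show ?thesis
    by (simp add: s_def field_simps)
qed

section \<open>Arbitrary arguments: splitting off the structure directions\<close>

lemma horizontal_part:
  assumes [simp]: "X \<in> V"
  shows "hor (- F (F X))"
    and "W \<in> V \<Longrightarrow> ip (- F (F X)) W p = ip (F X) (F W) p"
    and "ip (- F (F X)) (- F (F X)) p = ip (F X) (F X) p"
    and "F (- F (F X)) = F X"
proof -
  show "hor (- F (F X))"
    using hor_F[of "- F X"] by (simp add: F_uminus)
  show "W \<in> V \<Longrightarrow> ip (- F (F X)) W p = ip (F X) (F W) p"
    by (simp add: ip_uminus_left ip_FF_sym)
  show "ip (- F (F X)) (- F (F X)) p = ip (F X) (F X) p"
    by (simp add: ip_uminus_left ip_uminus_right hor_ip_F_F hor_F)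
  show "F (- F (F X)) = F X"
    by (simp add: F_uminus F_F_F)
qed

text \<open>The pointwise decomposition of W passes through the last slot because it is an inner
  product; the symmetries of \<open>Rm\<close> bring every other slot there.\<close>

lemma Rm_split4:
  assumes [simp]: "X \<in> V" "Y \<in> V" "Z \<in> V" "W \<in> V"
  shows "Rm X Y Z W p = Rm X Y Z (- F (F W)) p
    + ip xb W p * (ip xb X p * ip (F Y) (F Z) p - ip xb Y p * ip (F X) (F Z) p)"
proof -
  have "Rm X Y Z (F (F W)) p = - Rm X Y Z W p + (\<Sum>\<alpha>\<in>I. ip W (\<xi> \<alpha>) p * Rm X Y Z (\<xi> \<alpha>) p)"
    using ip_F_F[of W "R X Y Z" p] by (simp add: Rm_def ip_sym[of "R X Y Z"])
  also have "(\<Sum>\<alpha>\<in>I. ip W (\<xi> \<alpha>) p * Rm X Y Z (\<xi> \<alpha>) p)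
      = ip xb W p * (ip xb X p * ip (F Y) (F Z) p - ip xb Y p * ip (F X) (F Z) p)"
    by (simp add: Rm_xi4 ip_xb[of W] ip_sym[of W] sum_distrib_right)
  finally show ?thesis
    by (simp add: smul_uminus Rm_cmul4)
qed

text \<open>Z witnesses that L is nonzero at p, as \<open>f_sectional_quartic\<close> requires. All
  eta terms stem from the first two splittings; in the last two, both leading arguments are already
  horizontal.\<close>

lemma curvature_formula:
  assumes const: "\<And>X. hor X \<Longrightarrow> ip X X p = 1 \<Longrightarrow> Rm X (F X) (F X) X p = c"
    and [simp]: "X \<in> V" "Y \<in> V" and Z: "Z \<in> V" "ip (F Z) (F Z) p \<noteq> 0"
  shows "Rm X Y Y X p
    = (c + 3 * real (card I)) / 4 *
        (ip (F X) (F X) p * ip (F Y) (F Y) p - (ip (F X) (F Y) p)\<^sup>2)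
      + 3 * (c - real (card I)) / 4 * (ip X (F Y) p)\<^sup>2
      + (ip xb Y p)\<^sup>2 * ip (F X) (F X) p + (ip xb X p)\<^sup>2 * ip (F Y) (F Y) p
      - 2 * ip xb X p * ip xb Y p * ip (F X) (F Y) p"
proof -
  let ?X = "- F (F X)" and ?Y = "- F (F Y)"
  have h: "hor ?X" "hor ?Y" by (simp_all add: horizontal_part)
  note [simp] = hor_V[OF h(1)] hor_V[OF h(2)]
  have FZ: "hor (F Z)" "ip (F Z) (F Z) p > 0"
    using Z ip_nonneg[of "F Z" p] by (simp_all add: hor_F)
  note B = f_sectional_quartic[OF const FZ]
  have FF: "ip (F U) (F (- F (F W))) p = ip (F U) (F W) p" if "W \<in> V" for U W
    using that by (simp add: horizontal_part)
  have xb0: "ip xb ?X p = 0" "ip xb ?Y p = 0"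
    by (simp_all add: hor_xb h)
  have "Rm X Y Y X p = Rm X Y Y ?X p + ip xb X p * (ip xb X p * ip (F Y) (F Y) p - ip xb Y p * ip (F X) (F Y) p)"
    by (rule Rm_split4) auto
  also have "Rm X Y Y ?X p = Rm Y X ?X Y p"
    using Rm_skew12[of X Y Y ?X p] Rm_skew34[of Y X Y ?X p] by simp
  also have "\<dots> = Rm Y X ?X ?Y p + ip xb Y p * (ip xb Y p * ip (F X) (F X) p - ip xb X p * ip (F Y) (F X) p)"
    using Rm_split4[of Y X ?X Y p] by (simp add: FF)
  also have "Rm Y X ?X ?Y p = Rm ?X ?Y Y X p"
    by (simp add: Rm_pair[of Y X])
  also have "\<dots> = Rm ?X ?Y Y ?X p"
    using Rm_split4[of ?X ?Y Y X p] by (simp add: xb0)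
  also have "\<dots> = Rm ?Y ?X ?X Y p"
    using Rm_skew12[of ?X ?Y Y ?X p] Rm_skew34[of ?Y ?X Y ?X p] by simp
  also have "\<dots> = Rm ?Y ?X ?X ?Y p"
    using Rm_split4[of ?Y ?X ?X Y p] by (simp add: xb0)
  also have "\<dots> = Rm ?X ?Y ?Y ?X p"
    using Rm_skew12[of ?Y ?X ?X ?Y p] Rm_skew34[of ?X ?Y ?X ?Y p] by simp
  also have "\<dots> = (c + 3 * real (card I)) / 4 *
        (ip ?X ?X p * ip ?Y ?Y p - (ip ?X ?Y p)\<^sup>2)
      + 3 * (c - real (card I)) / 4 * (ip ?X (F ?Y) p)\<^sup>2"
    by (rule horizontal_sectional_curvature) (use B h in auto)
  also have "ip ?X ?Y p = ip (F X) (F Y) p"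
    by (simp add: horizontal_part(2)[of X ?Y] FF)
  also have "ip ?X (F ?Y) p = ip X (F Y) p"
    by (simp add: horizontal_part(4)[of Y] ip_uminus_left ip_F_F)
  finally show ?thesis
    using ip_sym[of "F Y" "F X" p]
    by (simp add: horizontal_part(3) algebra_simps power2_eq_square)
qed

subsection \<open>The semi-symmetric non-metric connection\<close>

definition Ds :: "'v \<Rightarrow> 'v \<Rightarrow> 'v" where
  "Ds X Y = D X Y + smul (ip xb Y) X"

text \<open>The bracket of fields stays \<open>br\<close>; the skew part of \<open>Ds\<close>
  differs from it by the torsion.\<close>

definition Rs :: "'v \<Rightarrow> 'v \<Rightarrow> 'v \<Rightarrow> 'v" where
  "Rs X Y Z = Ds X (Ds Y Z) - Ds Y (Ds X Z) - Ds (br X Y) Z"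

lemma Ds_V [simp]: "X \<in> V \<Longrightarrow> Y \<in> V \<Longrightarrow> Ds X Y \<in> V"
  by (simp add: Ds_def)

lemma Rs_V [simp]: "X \<in> V \<Longrightarrow> Y \<in> V \<Longrightarrow> Z \<in> V \<Longrightarrow> Rs X Y Z \<in> V"
  by (simp add: Rs_def)

lemma semi_symmetric_sectional:
  assumes [simp]: "X \<in> V" "Y \<in> V"
  shows "ip (Rs X Y Y) X p = Rm X Y Y X p + (ip xb Y p)\<^sup>2 * ip X X p
    - (real (card I) * ip Y (F X) p + ip xb X p * ip xb Y p) * ip X Y p"
proof -
  have DDs: "ip (Ds T (Ds U Y)) W p = ip (D T (D U Y)) W p + act T (ip xb Y) p * ip U W p
      + ip xb Y p * ip (D T U) W p + (ip xb (D U Y) p + ip xb Y p * ip xb U p) * ip T W p"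
    if "T \<in> V" "U \<in> V" "W \<in> V" for T U W
    using that by (simp add: Ds_def D_add_right D_smul_right ip_simps)
  \<comment> \<open>That is, (nabla_U eta)(Y) = -s g(F U, Y). It vanishes for U = Y, which leaves
    eta(Y)^2 as the only new coefficient of |X|^2.\<close>
  have xbD: "ip xb (D U Y) p = act U (ip xb Y) p + real (card I) * ip (F U) Y p" if "U \<in> V" for U
    using that by (simp add: metric D_xb ip_simps)
  have "ip (F Y) Y p = 0" "ip (F X) Y p = ip Y (F X) p" "ip Y X p = ip X Y p"
    using ip_sym[of "F Y" Y p] ip_sym[of "F X" Y p] ip_sym[of Y X p] by simp_all
  then show ?thesis
    by (simp add: Rs_def Rm_def R_def ip_simps DDs xbD)
       (simp add: Ds_def br_def ip_simps power2_eq_square algebra_simps)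
qed

text \<open>X and Y are horizontal at p only, which suffices to remove the eta terms from the
  formula for arbitrary fields; X itself serves as the witness Z.\<close>

theorem semi_symmetric_sectional_horizontal:
  assumes const: "\<And>X. hor X \<Longrightarrow> ip X X p = 1 \<Longrightarrow> Rm X (F X) (F X) X p = c"
    and [simp]: "X \<in> V" "Y \<in> V"
    and h: "\<And>\<alpha>. \<alpha> \<in> I \<Longrightarrow> ip X (\<xi> \<alpha>) p = 0" "\<And>\<alpha>. \<alpha> \<in> I \<Longrightarrow> ip Y (\<xi> \<alpha>) p = 0"
    and o: "ip X X p = 1" "ip Y Y p = 1" "ip X Y p = 0"
  shows "ip (Rs X Y Y) X p
    = (c + 3 * real (card I)) / 4 + 3 * (c - real (card I)) / 4 * (ip X (F Y) p)\<^sup>2"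
proof -
  have "ip (F X) (F X) p = 1" "ip (F Y) (F Y) p = 1" "ip (F X) (F Y) p = 0"
    using h o by (simp_all add: ip_F_F')
  moreover have "ip xb X p = 0" "ip xb Y p = 0"
    using h by (simp_all add: ip_xb ip_sym[of "\<xi> _"])
  ultimately show ?thesis
    using curvature_formula[OF const, of X Y X] o by (simp add: semi_symmetric_sectional)
qed

theorem semi_symmetric_scalar:
  fixes E :: "'j \<Rightarrow> 'v"
  assumes const: "\<And>X. hor X \<Longrightarrow> ip X X p = 1 \<Longrightarrow> Rm X (F X) (F X) X p = c"
    and J: "finite J" "card J = 2 * n + card I" "n \<ge> 1"
    and E [simp]: "\<And>i. i \<in> J \<Longrightarrow> E i \<in> V"
    and orth: "\<And>i j. i \<in> J \<Longrightarrow> j \<in> J \<Longrightarrow> ip (E i) (E j) p = (if i = j then 1 else 0)"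
    and parseval: "\<And>X Y. X \<in> V \<Longrightarrow> Y \<in> V \<Longrightarrow> (\<Sum>i\<in>J. ip X (E i) p * ip Y (E i) p) = ip X Y p"
  shows "(1/2) * (\<Sum>i\<in>J. \<Sum>j\<in>J. ip (Rs (E i) (E j) (E j)) (E i) p)
    = (real n * (real n + 1) * (c + 3 * real (card I)) + real (card I) * (real (card I) - 1)) / 2"
proof -
  define s where "s = real (card I)"
  define e where "e i = ip xb (E i) p" for i
  \<comment> \<open>The matrix of the projection -F^2 onto L in the frame; \<open>trP\<close>,
    \<open>PP\<close> and \<open>eP\<close> express its rank 2n, its idempotence and that it kills
    xi.\<close>
  define P where "P i j = ip (F (E i)) (F (E j)) p" for i j
  have ee: "(\<Sum>i\<in>J. (e i)\<^sup>2) = s"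
    using parseval[of xb xb] by (simp add: e_def ip_xb_xb s_def power2_eq_square)
  have "(\<Sum>i\<in>J. P i i) = (\<Sum>i\<in>J. 1 - (\<Sum>\<alpha>\<in>I. ip (\<xi> \<alpha>) (E i) p * ip (\<xi> \<alpha>) (E i) p))"
    by (rule sum.cong) (simp_all add: P_def ip_F_F' orth ip_sym[of "E _" "\<xi> _"])
  also have "\<dots> = real (card J) - (\<Sum>\<alpha>\<in>I. \<Sum>i\<in>J. ip (\<xi> \<alpha>) (E i) p * ip (\<xi> \<alpha>) (E i) p)"
    by (simp add: sum_subtractf sum.swap[of _ J I])
  finally have trP: "(\<Sum>i\<in>J. P i i) = 2 * real n"
    using J by (simp add: parseval ip_xi_xi)
  \<comment> \<open>A positive trace yields a frame vector with nonzero horizontal part, the witness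
    for \<open>curvature_formula\<close>.\<close>
  then obtain k where k: "k \<in> J" "P k k \<noteq> 0"
    using J by (metis (no_types, lifting) mult_eq_0_iff not_one_le_zero of_nat_eq_0_iff sum.neutral zero_neq_numeral)
  have P_eq: "P i j = ip (- F (F (E i))) (E j) p" if "i \<in> J" "j \<in> J" for i j
    using that by (simp add: P_def ip_uminus_left ip_FF_sym)
  have PP: "(\<Sum>j\<in>J. (P i j)\<^sup>2) = P i i" if [simp]: "i \<in> J" for i
  proof -
    have "(\<Sum>j\<in>J. (P i j)\<^sup>2) = ip (- F (F (E i))) (- F (F (E i))) p"
      by (subst parseval[symmetric]) (simp_all add: P_eq power2_eq_square)
    then show ?thesis by (simp add: horizontal_part P_def)
  qed
  have FF: "(\<Sum>j\<in>J. (ip (E i) (F (E j)) p)\<^sup>2) = P i i" if [simp]: "i \<in> J" for i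
    using parseval[of "F (E i)" "F (E i)"] by (simp add: F_skew power2_eq_square P_def)
  have eP: "(\<Sum>j\<in>J. e j * P i j) = 0" if [simp]: "i \<in> J" for i
    using parseval[of xb "- F (F (E i))"]
    by (simp add: P_eq e_def ip_uminus_right)
  define a b where "a = (c + 3 * s) / 4" and "b = 3 * (c - s) / 4"
  \<comment> \<open>The final summand corrects the diagonal, where E i and E j are not orthogonal
    and the added (e j)^2 must cancel.\<close>
  have sec: "ip (Rs (E i) (E j) (E j)) (E i) p
      = a * P i i * P j j - a * (P i j)\<^sup>2 + b * (ip (E i) (F (E j)) p)\<^sup>2
        + (e j)\<^sup>2 * P i i + (e i)\<^sup>2 * P j j - 2 * e i * (e j * P i j)
        + (e j)\<^sup>2 - (if i = j then (e i)\<^sup>2 else 0)" if [simp]: "i \<in> J" "j \<in> J" for i j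
  proof -
    have "Rm (E i) (E j) (E j) (E i) p = a * (P i i * P j j - (P i j)\<^sup>2)
        + b * (ip (E i) (F (E j)) p)\<^sup>2
        + (e j)\<^sup>2 * P i i + (e i)\<^sup>2 * P j j - 2 * e i * e j * P i j"
      using curvature_formula[OF const, of "E i" "E j" "E k"] k
      by (simp add: P_def e_def s_def a_def b_def)
    then show ?thesis
      by (auto simp: semi_symmetric_sectional orth e_def power2_eq_square algebra_simps)
  qed
  have "(\<Sum>j\<in>J. ip (Rs (E i) (E j) (E j)) (E i) p)
      = a * P i i * (2 * real n) - a * P i i + b * P i i
        + s * P i i + (e i)\<^sup>2 * (2 * real n) + s - (e i)\<^sup>2"
    if [simp]: "i \<in> J" for i
    by (simp add: sec sum.distrib sum_subtractf PP FF eP ee trP J(1)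
        flip: sum_distrib_left sum_distrib_right)
  then have "(\<Sum>i\<in>J. \<Sum>j\<in>J. ip (Rs (E i) (E j) (E j)) (E i) p)
      = a * (2 * real n) * (2 * real n) - a * (2 * real n)
        + b * (2 * real n) + s * (2 * real n) + s * (2 * real n) + (2 * real n + s) * s - s"
    using J ee trP
    by (simp add: sum.distrib sum_subtractf s_def flip: sum_distrib_left sum_distrib_right)
  then show ?thesis
    by (simp add: a_def b_def s_def field_simps)
qed

end

section \<open>Smooth functions and vector fields of a manifold\<close>

text \<open>\<open>frechet_derivative\<close> is a choice, so equality of the two derivative
  predicates is shown; this also covers points without a derivative.\<close>

lemma frechet_derivative_cong_open:
  assumes "open S" "x \<in> S" "\<And>y. y \<in> S \<Longrightarrow> h y = k y"
  shows "frechet_derivative h (at x) = frechet_derivative k (at x)"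
proof -
  have "(h has_derivative d) (at x) \<longleftrightarrow> (k has_derivative d) (at x)" for d
    using assms has_derivative_transform_within_open[of _ d x UNIV S] by metis
  then show ?thesis by (simp add: frechet_derivative_def)
qed

lemma k_smooth_on_cong:
  assumes "open S" "\<And>y. y \<in> S \<Longrightarrow> h y = k y"
  shows "k_smooth_on m S h \<longleftrightarrow> k_smooth_on m S k"
  using assms(2)
proof (induction m arbitrary: h k)
  case 0
  then show ?case by (simp cong: continuous_on_cong)
next
  case (Suc m)
  have "h differentiable (at x) \<longleftrightarrow> k differentiable (at x)" if "x \<in> S" for x
    using Suc.prems assms(1) that has_derivative_transform_within_open[of _ _ x UNIV S]
    unfolding differentiable_def by metis
  moreover have "k_smooth_on m S (\<lambda>x. frechet_derivative h (at x) v) \<longleftrightarrow>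
      k_smooth_on m S (\<lambda>x. frechet_derivative k (at x) v)" for v
    by (rule Suc.IH) (simp add: frechet_derivative_cong_open[OF assms(1) _ Suc.prems])
  ultimately show ?case by simp
qed

lemma k_smooth_on_Suc_imp: "k_smooth_on (Suc m) S h \<Longrightarrow> k_smooth_on m S h"
proof (induction m arbitrary: h)
  case 0
  then show ?case
    by (simp add: differentiable_imp_continuous_on differentiable_on_def differentiable_at_withinI)
next
  case (Suc m)
  from Suc.prems show ?case
    using Suc.IH by (simp del: k_smooth_on.simps add: k_smooth_on.simps(2))
qed

lemma k_smooth_on_const: "k_smooth_on m S (\<lambda>_. r)"
  by (induction m arbitrary: r) auto

lemma k_smooth_on_add:
  assumes "open S" "k_smooth_on m S h" "k_smooth_on m S k"
  shows "k_smooth_on m S (\<lambda>x. h x + k x)"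
  using assms(2,3)
proof (induction m arbitrary: h k)
  case 0
  then show ?case by (simp add: continuous_on_add)
next
  case (Suc m)
  have "frechet_derivative (\<lambda>x. h x + k x) (at x) v
      = frechet_derivative h (at x) v + frechet_derivative k (at x) v" if "x \<in> S" for x v
  proof -
    have "((\<lambda>x. h x + k x) has_derivative
        (\<lambda>v. frechet_derivative h (at x) v + frechet_derivative k (at x) v)) (at x)"
      using Suc.prems that by (intro has_derivative_add) (auto simp flip: frechet_derivative_works)
    from frechet_derivative_at[OF this] show ?thesis by metis
  qed
  moreover have "k_smooth_on m S (\<lambda>x. frechet_derivative h (at x) v + frechet_derivative k (at x) v)" for v
    by (rule Suc.IH) (use Suc.prems in auto)
  ultimately show ?case
    using Suc.prems k_smooth_on_cong[OF assms(1)] by (auto cong: k_smooth_on_cong[OF assms(1)])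
qed

lemma k_smooth_on_mult:
  fixes h k :: "'a::euclidean_space \<Rightarrow> real"
  assumes "open S" "k_smooth_on m S h" "k_smooth_on m S k"
  shows "k_smooth_on m S (\<lambda>x. h x * k x)"
  using assms(2,3)
proof (induction m arbitrary: h k)
  case 0
  then show ?case by (simp add: continuous_on_mult)
next
  case (Suc m)
  have "frechet_derivative (\<lambda>x. h x * k x) (at x) v
      = h x * frechet_derivative k (at x) v + frechet_derivative h (at x) v * k x" if "x \<in> S" for x v
  proof -
    have "((\<lambda>x. h x * k x) has_derivative
        (\<lambda>v. h x * frechet_derivative k (at x) v + frechet_derivative h (at x) v * k x)) (at x)"
      using Suc.prems that by (intro has_derivative_mult) (auto simp flip: frechet_derivative_works)
    from frechet_derivative_at[OF this] show ?thesis by metis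
  qed
  \<comment> \<open>The product rule keeps h and k themselves, hence the descent from order
    \<open>Suc m\<close> to m.\<close>
  moreover have "k_smooth_on m S (\<lambda>x. h x * frechet_derivative k (at x) v + frechet_derivative h (at x) v * k x)" for v
    by (intro k_smooth_on_add[OF assms(1)] Suc.IH) (use Suc.prems k_smooth_on_Suc_imp in auto)
  ultimately show ?case
    using Suc.prems by (auto cong: k_smooth_on_cong[OF assms(1)])
qed

lemma smooth_funs_const: "(\<lambda>_. r) \<in> smooth_funs A"
  by (auto simp: smooth_funs_def smooth_on_def o_def k_smooth_on_const)

lemma smooth_manifold_chart_open: "smooth_manifold A \<Longrightarrow> (U, \<phi>) \<in> A \<Longrightarrow> open (\<phi> ` U)"
  by (auto simp: smooth_manifold_def)

lemma smooth_funs_add: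
  assumes "smooth_manifold A" "h \<in> smooth_funs A" "k \<in> smooth_funs A"
  shows "(\<lambda>q. h q + k q) \<in> smooth_funs A"
  unfolding smooth_funs_def smooth_on_def o_def
proof (safe intro!: k_smooth_on_add)
qed (use assms smooth_manifold_chart_open in \<open>fastforce simp: smooth_funs_def smooth_on_def o_def\<close>)+

lemma smooth_funs_mult:
  assumes "smooth_manifold A" "h \<in> smooth_funs A" "k \<in> smooth_funs A"
  shows "(\<lambda>q. h q * k q) \<in> smooth_funs A"
  unfolding smooth_funs_def smooth_on_def o_def
proof (safe intro!: k_smooth_on_mult)
qed (use assms smooth_manifold_chart_open in \<open>fastforce simp: smooth_funs_def smooth_on_def o_def\<close>)+

lemma tangent_space_comb:
  assumes "u \<in> tangent_space A p" "v \<in> tangent_space A p"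
  shows "(\<lambda>F. a * u F + b * v F) \<in> tangent_space A p"
  using assms by (auto simp: tangent_space_def algebra_simps)

lemma tangent_space_zero: "(\<lambda>F. 0) \<in> tangent_space A p"
  by (simp add: tangent_space_def)

lemma tangent_nonsmooth: "v \<in> tangent_space A p \<Longrightarrow> F \<notin> smooth_funs A \<Longrightarrow> v F = 0"
  by (simp add: tangent_space_def)

lemma vfields_tangent: "X \<in> vfields A \<Longrightarrow> X p \<in> tangent_space A p"
  by (simp add: vfields_def)

definition vf_smul :: "('p \<Rightarrow> real) \<Rightarrow> 'p vfield \<Rightarrow> 'p vfield" where
  "vf_smul h X = (\<lambda>p F. h p * X p F)"

definition vf_act :: "'p vfield \<Rightarrow> ('p \<Rightarrow> real) \<Rightarrow> 'p \<Rightarrow> real" where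
  "vf_act X h = (\<lambda>p. X p h)"

definition vf_ip :: "('p \<Rightarrow> 'p tvec \<Rightarrow> 'p tvec \<Rightarrow> real) \<Rightarrow> 'p vfield \<Rightarrow> 'p vfield \<Rightarrow> 'p \<Rightarrow> real" where
  "vf_ip g X Y = (\<lambda>p. g p (X p) (Y p))"

lemma vf_add: "X + Y = (\<lambda>p F. X p F + Y p F)" for X Y :: "'p vfield"
  by (simp add: plus_fun_def)

lemma vf_sum_apply: "(sum X I) p F = (\<Sum>i\<in>I. X i p F)" for X :: "'i \<Rightarrow> 'p vfield"
  by (induction I rule: infinite_finite_induct) simp_all

lemma vfields_add:
  assumes "smooth_manifold A" "X \<in> vfields A" "Y \<in> vfields A"
  shows "X + Y \<in> vfields A"
  using assms tangent_space_comb[of "X _" A _ "Y _" 1 1]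
  by (auto simp: vfields_def vf_add intro: smooth_funs_add)

lemma vfields_smul:
  assumes "smooth_manifold A" "h \<in> smooth_funs A" "X \<in> vfields A"
  shows "vf_smul h X \<in> vfields A"
proof -
  have "(\<lambda>F. h p * X p F) \<in> tangent_space A p" for p
    using tangent_space_comb[of "X p" A p "X p" "h p" 0] assms by (simp add: vfields_tangent)
  then show ?thesis
    using assms by (auto simp: vfields_def vf_smul_def intro: smooth_funs_mult)
qed

section \<open>The manifold as a model of the abstract setting\<close>

lemma levi_civita_lie_rinehart:
  assumes M: "smooth_manifold A" and g: "riemannian_metric A g" and D: "levi_civita A g D"
  shows "lie_rinehart (smooth_funs A) (vfields A) vf_smul vf_act (vf_ip g) D"
proof -
  note T = vfields_tangent
  have gadd: "g p (\<lambda>F. a * X p F + b * Y p F) (Z p) = a * g p (X p) (Z p) + b * g p (Y p) (Z p)"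
    if "X \<in> vfields A" "Y \<in> vfields A" "Z \<in> vfields A" for X Y Z p a b
    using g T[OF that(1)] T[OF that(2)] T[OF that(3)] unfolding riemannian_metric_def by blast
  have lc: "linear_connection A D" using D by (simp add: levi_civita_def)
  show ?thesis
  proof
    fix r :: real show "(\<lambda>_. r) \<in> smooth_funs A" by (rule smooth_funs_const)
  next
    show "(0 :: 'a vfield) \<in> vfields A"
      by (auto simp: vfields_def zero_fun_def tangent_space_zero smooth_funs_const)
  next
    fix X :: "'a vfield" show "- X = vf_smul (\<lambda>_. - 1) X"
      by (intro ext) (simp add: vf_smul_def)
  next
    fix X a b h k p assume "X \<in> vfields A" "h \<in> smooth_funs A" "k \<in> smooth_funs A"
    then show "vf_act X (\<lambda>q. a * h q + b * k q) p = a * vf_act X h p + b * vf_act X k p"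
      "vf_act X (\<lambda>q. h q * k q) p = h p * vf_act X k p + k p * vf_act X h p"
      using T[of X A p] by (simp_all add: vf_act_def tangent_space_def)
  next
    fix X Y assume X: "X \<in> vfields A" "Y \<in> vfields A"
      and e: "\<And>h p. h \<in> smooth_funs A \<Longrightarrow> vf_act X h p = vf_act Y h p"
    \<comment> \<open>Tangent vectors are 0 off the smooth functions, so agreement on these is
      equality in HOL.\<close>
    show "X = Y"
    proof (intro ext)
      fix p F
      show "X p F = Y p F"
        using e[of F p] tangent_nonsmooth[OF T[OF X(1)], of F] tangent_nonsmooth[OF T[OF X(2)], of F]
        by (cases "F \<in> smooth_funs A") (auto simp: vf_act_def)
    qed
  next
    fix X Y p assume "X \<in> vfields A" "Y \<in> vfields A"
    then show "vf_ip g X Y p = vf_ip g Y X p"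
      using g T[of X A p] T[of Y A p] by (simp add: vf_ip_def riemannian_metric_def)
  next
    fix X Y Z p assume "X \<in> vfields A" "Y \<in> vfields A" "Z \<in> vfields A"
    then show "vf_ip g (X + Y) Z p = vf_ip g X Z p + vf_ip g Y Z p"
      using gadd[of X Y Z p 1 1] by (simp add: vf_ip_def vf_add)
  next
    fix X Y h p assume "h \<in> smooth_funs A" "X \<in> vfields A" "Y \<in> vfields A"
    then show "vf_ip g (vf_smul h X) Y p = h p * vf_ip g X Y p"
      using gadd[of X X Y p "h p" 0] by (simp add: vf_ip_def vf_smul_def)
  next
    fix X p assume X: "X \<in> vfields A"
    have z: "g p (\<lambda>F. 0) (\<lambda>F. 0) = 0"
    proof -
      have "0 \<in> vfields A"
        by (auto simp: vfields_def zero_fun_def tangent_space_zero smooth_funs_const)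
      from gadd[OF this this this, of p 0 0] show ?thesis by (simp add: zero_fun_def)
    qed
    show "vf_ip g X X p \<ge> 0"
    proof (cases "X p = (\<lambda>F. 0)")
      case True
      then show ?thesis using z by (simp add: vf_ip_def)
    next
      case False
      then have "g p (X p) (X p) > 0"
        using g T[OF X, of p] unfolding riemannian_metric_def by blast
      then show ?thesis by (simp add: vf_ip_def)
    qed
  next
    fix X assume X: "X \<in> vfields A" and e: "\<And>p. vf_ip g X X p = 0"
    show "X = 0"
    proof
      fix p
      have "X p = (\<lambda>F. 0)"
        using g T[OF X, of p] e[of p] unfolding riemannian_metric_def vf_ip_def
        by (metis less_irrefl)
      then show "X p = 0 p" by (simp add: zero_fun_def)
    qed
  next
    fix X Y Z p assume "X \<in> vfields A" "Y \<in> vfields A" "Z \<in> vfields A"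
    then show "vf_act X (vf_ip g Y Z) p = vf_ip g (D X Y) Z p + vf_ip g Y (D X Z) p"
      using D by (simp add: levi_civita_def vf_act_def vf_ip_def)
  next
    fix X Y h p assume "X \<in> vfields A" "Y \<in> vfields A" "h \<in> smooth_funs A"
    then show "vf_act (D X Y - D Y X) h p = vf_act X (vf_act Y h) p - vf_act Y (vf_act X h) p"
      using D by (simp add: levi_civita_def vf_act_def lie_bracket_def)
  next
    fix X Y h p assume "h \<in> smooth_funs A" "X \<in> vfields A" "Y \<in> vfields A"
    then show "D (vf_smul h X) Y = vf_smul h (D X Y)"
      "D X (vf_smul h Y) = vf_smul (vf_act X h) Y + vf_smul h (D X Y)"
      using lc by (simp_all add: linear_connection_def vf_smul_def vf_add vf_act_def)
  next
    fix X Y Z assume "X \<in> vfields A" "Y \<in> vfields A" "Z \<in> vfields A"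
    then show "D (X + Y) Z = D X Z + D Y Z" "D X (Y + Z) = D X Y + D X Z"
      using lc by (simp_all add: linear_connection_def vf_add)
  next
    fix X Y h p assume "X \<in> vfields A" "Y \<in> vfields A" "h \<in> smooth_funs A"
    then show "vf_act (X + Y) h p = vf_act X h p + vf_act Y h p"
      by (simp add: vf_act_def)
  next
    fix X h k p
    show "vf_act (vf_smul k X) h p = k p * vf_act X h p"
      by (simp add: vf_act_def vf_smul_def)
  next
    fix X h assume "X \<in> vfields A" "h \<in> smooth_funs A"
    then show "vf_act X h \<in> smooth_funs A"
      by (simp add: vf_act_def vfields_def)
  next
    fix X Y assume "X \<in> vfields A" "Y \<in> vfields A"
    then show "vf_ip g X Y \<in> smooth_funs A" "D X Y \<in> vfields A"
      using g lc by (simp_all add: vf_ip_def riemannian_metric_def linear_connection_def)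
  qed (rule smooth_funs_add smooth_funs_mult vfields_add vfields_smul; use M in simp)+
qed

lemma S_manifold_structure:
  assumes S: "S_manifold A n s f \<xi> \<eta> g" and D: "levi_civita A g D"
  shows "S_structure (smooth_funs A) (vfields A) vf_smul vf_act (vf_ip g) D (apply_tensor f) \<xi> {1..s}"
proof -
  have mf: "metric_f_manifold A n s f \<xi> \<eta> g" and nm: "normal_structure A s f \<xi> \<eta>"
    and ct: "\<And>\<alpha> X Y p. \<alpha> \<in> {1..s} \<Longrightarrow> X \<in> vfields A \<Longrightarrow> Y \<in> vfields A \<Longrightarrow>
      fundamental_form g f X Y p = ext_deriv (\<eta> \<alpha>) X Y p"
    using S by (auto simp: S_manifold_def)
  have M: "smooth_manifold A" and g: "riemannian_metric A g" and tf: "tensor_field_1_1 A f"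
    and s1: "s \<ge> 1" and xi: "\<And>\<alpha>. \<alpha> \<in> {1..s} \<Longrightarrow> \<xi> \<alpha> \<in> vfields A"
    using mf by (auto simp: metric_f_manifold_def)
  \<comment> \<open>Keeps \<open>{1..s}\<close> and membership in it syntactically intact, so that
    assumptions about indices match.\<close>
  note One_nat_def [simp del] and atLeastAtMost_iff [simp del] and xi [simp]
  interpret L: lie_rinehart "smooth_funs A" "vfields A" vf_smul vf_act "vf_ip g" D
    by (rule levi_civita_lie_rinehart[OF M g D])
  note T = vfields_tangent
  have eta: "\<eta> \<alpha> p (X p) = vf_ip g X (\<xi> \<alpha>) p" if "\<alpha> \<in> {1..s}" "X \<in> vfields A" for \<alpha> X p
    using mf that T[of X A p] by (simp add: metric_f_manifold_def vf_ip_def)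
  have fadd: "f p (\<lambda>F. a * X p F + b * Y p F) = (\<lambda>F. a * f p (X p) F + b * f p (Y p) F)"
    if "X \<in> vfields A" "Y \<in> vfields A" for X Y p a b
    using tf T[OF that(1)] T[OF that(2)] unfolding tensor_field_1_1_def by blast
  have fV: "apply_tensor f X \<in> vfields A" if "X \<in> vfields A" for X
    using tf that by (simp add: tensor_field_1_1_def apply_tensor_def)
  have br: "lie_bracket X Y = L.br X Y" if "X \<in> vfields A" "Y \<in> vfields A" for X Y
    using D that by (intro ext) (simp add: L.br_def levi_civita_def)
  show ?thesis
  proof (unfold_locales)
    fix X W p assume X: "X \<in> vfields A" and W: "W \<in> vfields A"
    have "apply_tensor f (apply_tensor f X)
        = (\<Sum>\<alpha>=1..s. vf_smul (vf_ip g X (\<xi> \<alpha>)) (\<xi> \<alpha>)) - X"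
    proof (intro ext)
      fix p F
      have "f p (f p (X p)) = (\<lambda>F. - X p F + (\<Sum>\<alpha>=1..s. \<eta> \<alpha> p (X p) * \<xi> \<alpha> p F))"
        using mf T[OF X, of p] by (simp add: metric_f_manifold_def)
      then show "apply_tensor f (apply_tensor f X) p F
          = ((\<Sum>\<alpha>=1..s. vf_smul (vf_ip g X (\<xi> \<alpha>)) (\<xi> \<alpha>)) - X) p F"
        using X by (simp add: apply_tensor_def vf_sum_apply vf_smul_def eta)
    qed
    then show "vf_ip g (apply_tensor f (apply_tensor f X)) W p
      = - vf_ip g X W p + (\<Sum>\<alpha>\<in>{1..s}. vf_ip g X (\<xi> \<alpha>) p * vf_ip g (\<xi> \<alpha>) W p)"
      using X W xi by (simp add: L.ip_simps)
  next
    fix X Y p assume X: "X \<in> vfields A" and Y: "Y \<in> vfields A"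
    then show "vf_ip g X (apply_tensor f Y) p = - vf_ip g (apply_tensor f X) Y p"
      using mf T[of X A p] T[of Y A p] by (simp add: metric_f_manifold_def vf_ip_def apply_tensor_def)
    show "apply_tensor f (X + Y) = apply_tensor f X + apply_tensor f Y"
      using fadd[OF X Y, of _ 1 1] by (simp add: apply_tensor_def vf_add)
  next
    fix X Y W p assume X: "X \<in> vfields A" and Y: "Y \<in> vfields A" and W: "W \<in> vfields A"
    let ?f = "apply_tensor f"
    let ?N = "?f (?f (L.br X Y)) + L.br (?f X) (?f Y) - ?f (L.br (?f X) Y) - ?f (L.br X (?f Y))"
    \<comment> \<open>All d eta^a coincide, so the vertical term of normality has one smooth
      coefficient common to all xi_a.\<close>
    define h where "h q = -2 * vf_ip g X (?f Y) q" for q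
    have hC: "h \<in> smooth_funs A"
      unfolding h_def using X Y fV by (intro L.C_cmul L.ip_C)
    have "?N = (\<Sum>\<alpha>=1..s. vf_smul h (\<xi> \<alpha>))"
    proof (intro ext)
      fix p F
      have "nijenhuis f X Y p F + 2 * (\<Sum>\<alpha>=1..s. ext_deriv (\<eta> \<alpha>) X Y p * \<xi> \<alpha> p F) = 0"
        using nm X Y by (simp add: normal_structure_def)
      moreover have "ext_deriv (\<eta> \<alpha>) X Y p = vf_ip g X (?f Y) p" if "\<alpha> \<in> {1..s}" for \<alpha>
        using ct[OF that X Y, of p] by (simp add: fundamental_form_def vf_ip_def apply_tensor_def)
      ultimately show "?N p F = (\<Sum>\<alpha>=1..s. vf_smul h (\<xi> \<alpha>)) p F"
        by (simp add: nijenhuis_def Let_def br X Y fV vf_sum_apply vf_smul_def h_def sum_negf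
            mult.assoc flip: sum_distrib_left)
    qed
    moreover have "vf_ip g (\<Sum>\<alpha>=1..s. vf_smul h (\<xi> \<alpha>)) W p = h p * (\<Sum>\<alpha>=1..s. vf_ip g (\<xi> \<alpha>) W p)"
      using hC W by (simp add: L.ip_sum_left L.ip_smul_left sum_distrib_left)
    ultimately show "vf_ip g ?N W p = - 2 * vf_ip g X (?f Y) p * (\<Sum>\<alpha>\<in>{1..s}. vf_ip g (\<xi> \<alpha>) W p)"
      by (simp only: h_def)
  next
    fix \<alpha> X Y p assume \<alpha>: "\<alpha> \<in> {1..s}" and X: "X \<in> vfields A" and Y: "Y \<in> vfields A"
    have "(\<lambda>q. \<eta> \<alpha> q (Z q)) = vf_ip g Z (\<xi> \<alpha>)" if "Z \<in> vfields A" for Z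
      using eta[OF \<alpha> that] by auto
    then show "2 * vf_ip g X (apply_tensor f Y) p = vf_act X (vf_ip g Y (\<xi> \<alpha>)) p
        - vf_act Y (vf_ip g X (\<xi> \<alpha>)) p - vf_ip g (L.br X Y) (\<xi> \<alpha>) p"
      using ct[OF \<alpha> X Y, of p] eta[OF \<alpha> L.br_V[OF X Y], of p] X Y
      by (simp add: fundamental_form_def ext_deriv_def vf_ip_def apply_tensor_def vf_act_def br)
  next
    fix \<alpha> \<beta> p assume "\<alpha> \<in> {1..s}" "\<beta> \<in> {1..s}"
    then show "vf_ip g (\<xi> \<alpha>) (\<xi> \<beta>) p = (if \<alpha> = \<beta> then 1 else 0)"
      using mf eta[of \<beta> "\<xi> \<alpha>" p] xi[of \<alpha>] unfolding metric_f_manifold_def by auto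
  next
    fix \<alpha> assume "\<alpha> \<in> {1..s}"
    then show "apply_tensor f (\<xi> \<alpha>) = 0"
      using mf by (auto simp: metric_f_manifold_def apply_tensor_def zero_fun_def)
  next
    fix h X assume "h \<in> smooth_funs A" "X \<in> vfields A"
    then show "apply_tensor f (vf_smul h X) = vf_smul h (apply_tensor f X)"
      using fadd[of X X _ "h _" 0] by (simp add: apply_tensor_def vf_smul_def)
  qed (use s1 xi fV in auto)
qed

theorem mainTheorem8:
  fixes A :: "('p::{t2_space,second_countable_topology}, 'e::euclidean_space) atlas"
    and n s :: nat
    and f :: "'p \<Rightarrow> 'p tvec \<Rightarrow> 'p tvec"
    and \<xi> :: "nat \<Rightarrow> 'p vfield"
    and \<eta> :: "nat \<Rightarrow> 'p \<Rightarrow> 'p tvec \<Rightarrow> real"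
    and g :: "'p \<Rightarrow> 'p tvec \<Rightarrow> 'p tvec \<Rightarrow> real"
    and D :: "'p vfield \<Rightarrow> 'p vfield \<Rightarrow> 'p vfield"
    and c :: real
  assumes "S_manifold A n s f \<xi> \<eta> g"
    and "levi_civita A g D"
    and "constant_f_sectional_curvature A s f \<xi> g D c"
  shows "(\<forall>X\<in>vfields A. \<forall>Y\<in>vfields A. \<forall>p.
            X p \<in> distr_L A s \<xi> g p \<and> Y p \<in> distr_L A s \<xi> g p \<and>
            g p (X p) (X p) = 1 \<and> g p (Y p) (Y p) = 1 \<and> g p (X p) (Y p) = 0 \<longrightarrow>
            sectional_curvature g (semi_symmetric_connection s \<eta> D) X Y p =
              (c + 3 * real s) / 4 + 3 * (c - real s) / 4 * (g p (X p) (f p (Y p)))\<^sup>2) \<and>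
         (\<forall>U E. local_orthonormal_frame A g U (2 * n + s) E \<longrightarrow>
            (\<forall>p\<in>U. scalar_curvature g (semi_symmetric_connection s \<eta> D) (2 * n + s) E p =
              (real n * (real n + 1) * (c + 3 * real s) + real s * (real s - 1)) / 2))"
proof -
  note One_nat_def [simp del]
  interpret S_structure "smooth_funs A" "vfields A" vf_smul vf_act "vf_ip g" D "apply_tensor f" \<xi> "{1..s}"
    by (rule S_manifold_structure[OF assms(1,2)])
  have mf: "metric_f_manifold A n s f \<xi> \<eta> g"
    using assms(1) by (simp add: S_manifold_def)
  have br: "lie_bracket X Y = br X Y" if "X \<in> vfields A" "Y \<in> vfields A" for X Y
    using assms(2) that by (intro ext) (simp add: br_def levi_civita_def)
  have const: "Rm X (apply_tensor f X) (apply_tensor f X) X p = c"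
    if X: "hor X" "vf_ip g X X p = 1" for X p
  proof -
    have "X p \<in> distr_L A s \<xi> g p"
      using X by (auto simp: hor_def distr_L_def vf_ip_def vfields_tangent)
    then have "sectional_curvature g D X (apply_tensor f X) p = c"
      using assms(3) X by (simp add: constant_f_sectional_curvature_def hor_V vf_ip_def)
    moreover have "curvature D X Y Z = R X Y Z" if "X \<in> vfields A" "Y \<in> vfields A" for X Y Z
      using that by (intro ext) (simp add: curvature_def R_def br)
    ultimately show ?thesis
      using hor_V[OF X(1)] by (simp add: sectional_curvature_def Rm_def vf_ip_def)
  qed
  have Ds: "semi_symmetric_connection s \<eta> D X Y = Ds X Y" if "X \<in> vfields A" "Y \<in> vfields A" for X Y
  proof (intro ext)
    fix p F
    have "\<eta> \<alpha> p (Y p) = vf_ip g (\<xi> \<alpha>) Y p" if "\<alpha> \<in> {1..s}" for \<alpha>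
    proof -
      have "\<eta> \<alpha> p (Y p) = vf_ip g Y (\<xi> \<alpha>) p"
        using mf that \<open>Y \<in> vfields A\<close> vfields_tangent[of Y A p]
        by (simp add: metric_f_manifold_def vf_ip_def)
      then show ?thesis using that \<open>Y \<in> vfields A\<close> by (simp add: ip_sym[of Y])
    qed
    then show "semi_symmetric_connection s \<eta> D X Y p F = Ds X Y p F"
      using that by (simp add: semi_symmetric_connection_def Ds_def vf_smul_def ip_xb)
  qed
  have sec: "sectional_curvature g (semi_symmetric_connection s \<eta> D) X Y p = vf_ip g (Rs X Y Y) X p"
    if "X \<in> vfields A" "Y \<in> vfields A" for X Y p
  proof -
    have "curvature (semi_symmetric_connection s \<eta> D) X Y Y = Rs X Y Y"
      using that by (intro ext) (simp add: curvature_def Rs_def br Ds)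
    then show ?thesis by (simp add: sectional_curvature_def vf_ip_def)
  qed
  show ?thesis
  proof (intro conjI ballI allI impI)
    fix X Y p
    assume X: "X \<in> vfields A" and Y: "Y \<in> vfields A"
      and h: "X p \<in> distr_L A s \<xi> g p \<and> Y p \<in> distr_L A s \<xi> g p \<and>
            g p (X p) (X p) = 1 \<and> g p (Y p) (Y p) = 1 \<and> g p (X p) (Y p) = 0"
    have "vf_ip g (Rs X Y Y) X p = (c + 3 * real (card {1..s})) / 4
        + 3 * (c - real (card {1..s})) / 4 * (vf_ip g X (apply_tensor f Y) p)\<^sup>2"
      by (rule semi_symmetric_sectional_horizontal[OF const])
         (use X Y h in \<open>auto simp: vf_ip_def distr_L_def\<close>)
    then show "sectional_curvature g (semi_symmetric_connection s \<eta> D) X Y p =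
        (c + 3 * real s) / 4 + 3 * (c - real s) / 4 * (g p (X p) (f p (Y p)))\<^sup>2"
      using sec[OF X Y] by (simp add: vf_ip_def apply_tensor_def)
  next
    fix U E p
    assume fr: "local_orthonormal_frame A g U (2 * n + s) E" and p: "p \<in> U"
    let ?J = "{1..2 * n + s}"
    have E: "E i \<in> vfields A" if "i \<in> ?J" for i
      using fr that by (auto simp: local_orthonormal_frame_def)
    have orth: "vf_ip g (E i) (E j) p = (if i = j then 1 else 0)" if "i \<in> ?J" "j \<in> ?J" for i j
      using fr p that by (simp add: local_orthonormal_frame_def vf_ip_def)
    have parseval: "(\<Sum>i\<in>?J. vf_ip g X (E i) p * vf_ip g Y (E i) p) = vf_ip g X Y p"
      if X: "X \<in> vfields A" and Y: "Y \<in> vfields A" for X Y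
    proof -
      obtain a where a: "X p = (\<lambda>F. \<Sum>i\<in>?J. a i * E i p F)"
        using fr p vfields_tangent[OF X, of p] unfolding local_orthonormal_frame_def by blast
      \<comment> \<open>The coefficients a exist at p only; frozen as constants they give a global
        field agreeing with X at p, which is all that the metric at p sees.\<close>
      define Z where "Z = (\<Sum>i\<in>?J. vf_smul (\<lambda>_. a i) (E i))"
      have "X p = Z p"
        by (intro ext) (simp add: a Z_def vf_sum_apply vf_smul_def)
      then have XW: "vf_ip g X W p = (\<Sum>i\<in>?J. a i * vf_ip g (E i) W p)" if "W \<in> vfields A" for W
      proof -
        have "vf_ip g X W p = vf_ip g Z W p"
          using \<open>X p = Z p\<close> by (simp add: vf_ip_def)
        also have "\<dots> = (\<Sum>i\<in>?J. a i * vf_ip g (E i) W p)"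
          unfolding Z_def using E that by (subst ip_sum_left) (auto simp: ip_smul_left)
        finally show ?thesis .
      qed
      have "vf_ip g X (E j) p = a j" if "j \<in> ?J" for j
      proof -
        have "vf_ip g X (E j) p = (\<Sum>i\<in>?J. a i * (if i = j then 1 else 0))"
          using that E orth by (subst XW) auto
        also have "\<dots> = a j" using that by (simp add: if_distrib[of "(*) _"] cong: if_cong)
        finally show ?thesis .
      qed
      moreover have "vf_ip g Y (E i) p = vf_ip g (E i) Y p" if "i \<in> ?J" for i
        using E[OF that] Y by (rule ip_sym[rotated])
      ultimately show ?thesis using XW[OF Y] by simp
    qed
    have "(1/2) * (\<Sum>i\<in>?J. \<Sum>j\<in>?J. vf_ip g (Rs (E i) (E j) (E j)) (E i) p)
      = (real n * (real n + 1) * (c + 3 * real (card {1..s}))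
          + real (card {1..s}) * (real (card {1..s}) - 1)) / 2"
      by (rule semi_symmetric_scalar[OF const])
         (use mf E orth parseval in \<open>auto simp: metric_f_manifold_def\<close>)
    moreover have "(\<Sum>i\<in>?J. \<Sum>j\<in>?J. vf_ip g (Rs (E i) (E j) (E j)) (E i) p)
        = (\<Sum>i\<in>?J. \<Sum>j\<in>?J. sectional_curvature g (semi_symmetric_connection s \<eta> D) (E i) (E j) p)"
      using sec E by (intro sum.cong refl) simp
    ultimately show "scalar_curvature g (semi_symmetric_connection s \<eta> D) (2 * n + s) E p =
        (real n * (real n + 1) * (c + 3 * real s) + real s * (real s - 1)) / 2"
      by (simp add: scalar_curvature_def)
  qed
qed

end
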